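(* Let $\Gamma$ be a nonbipartite dual polar graph (i.e. $e\ne -1$), fix a vertex $x$, and let $\mathcal P$ be the set of subspaces of $x$. For $\eta\in\mathcal P$ let $\eta^{\mathcal N}=\sum_{y\in X,\ x\cap y=\eta}\hat y$. Let $0\le i\le D$ and let $\eta\in\mathcal P$ with $\dim\eta=D-i$. Then $$A\eta^{\mathcal N}=a_1\frac{q^i-1}{q-1}\,\eta^{\mathcal N}+\sum_{\zeta}\zeta^{\mathcal N}+(a_1+1)q^{i-1}\sum_{\zeta'}\zeta'^{\mathcal N},$$ where the first sum is over all subspaces $\zeta\subseteq\eta$ with $\dim\zeta=D-i-1$, and the second sum is over all subspaces $\zeta'$ with $\eta\subseteq\zeta'\subseteq x$ and $\dim\zeta'=D-i+1$. Moreover $A^*\eta^{\mathcal N}=\theta^*_i\eta^{\mathcal N}$.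
   Context: Dual polar graph: let $\mathbf U$ be a finite vector space with a nondegenerate form of one of the following types, with parameters $(q,e)$ ($p$ prime, $n\ge1$): $B_D(p^n)$: $\dim\mathbf U=2D+1$ over $GF(p^n)$, quadratic form, $q=p^n$, $e=0$; $C_D(p^n)$: $\dim 2D$ over $GF(p^n)$, symplectic, $q=p^n$, $e=0$; $D_D(p^n)$: $\dim 2D$ over $GF(p^n)$, quadratic of Witt index $D$, $q=p^n$, $e=-1$; ${}^2D_{D+1}(p^n)$: $\dim 2D+2$ over $GF(p^n)$, quadratic of Witt index $D$, $q=p^n$, $e=1$; ${}^2A_{2D}(p^n)$: $\dim 2D+1$ over $GF(p^{2n})$, Hermitian, $q=p^{2n}$, $e=1/2$; ${}^2A_{2D-1}(p^n)$: $\dim 2D$ over $GF(p^{2n})$, Hermitian, $q=p^{2n}$, $e=-1/2$. Here $D\ge1$. A subspace is isotropic if the form vanishes on it; maximal isotropic subspaces have dimension $D$. The dual polar graph $\Gamma$ has vertex set $X$ the maximal isotropic subspaces, with $y,z$ adjacent iff $\dim(y\cap z)=D-1$; its distance is $\partial(y,z)=D-\dim(y\cap z)$; $a_1=q^{e+1}-1$. Let $A$ be its adjacency matrix and $V=\mathbb C^X$ with standard basis $\hat y$. For $0\le i\le D$ let $E_i$ be the primitive idempotent of $A$ for the eigenvalue $\theta_i=\frac{(a_1+1)q^{D-i}-q^i-a_1}{q-1}$ (a $Q$-polynomial ordering). Let $A^*=A^*(x)$ be the diagonal matrix with $(y,y)$-entry $|X|(E_1)_{x,y}$ (the dual adjacency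 matrix), and let $\theta^*_i$ be the eigenvalue of $A^*$ on $\mathrm{Span}\{\hat y:\partial(x,y)=i\}$ (namely $\theta^*_i=\frac{q^{D+e}+q}{q^e+1}\cdot\frac{q^{-i}(q^{D+e}+1)-q^e-1}{q-1}$). *)

theory Defs
  imports Complex_Main "HOL-Library.Cardinality" "HOL-Computational_Algebra.Primes"
begin

datatype ('f, 'u) form =
    Quadratic "'u \<Rightarrow> 'f"
  | Symplectic "'u \<Rightarrow> 'u \<Rightarrow> 'f"
  | Hermitian "'u \<Rightarrow> 'u \<Rightarrow> 'f"

definition polar_form :: "('u::ab_group_add \<Rightarrow> 'f::field) \<Rightarrow> 'u \<Rightarrow> 'u \<Rightarrow> 'f" where
  "polar_form Q v w = Q (v + w) - Q v - Q w"

definition bilinear_form ::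
  "('f::field \<Rightarrow> 'u::ab_group_add \<Rightarrow> 'u) \<Rightarrow> ('u \<Rightarrow> 'u \<Rightarrow> 'f) \<Rightarrow> bool" where
  "bilinear_form scale B \<longleftrightarrow>
     (\<forall>w. Vector_Spaces.linear scale (*) (\<lambda>v. B v w)) \<and>
     (\<forall>v. Vector_Spaces.linear scale (*) (\<lambda>w. B v w))"

definition quadratic_form ::
  "('f::field \<Rightarrow> 'u::ab_group_add \<Rightarrow> 'u) \<Rightarrow> ('u \<Rightarrow> 'f) \<Rightarrow> bool" where
  "quadratic_form scale Q \<longleftrightarrow>
     (\<forall>a v. Q (scale a v) = a ^ 2 * Q v) \<and> bilinear_form scale (polar_form Q)"

text \<open>
  Nondegeneracy of a quadratic form: no nonzero vector of the radical of the polar form is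
  singular. In odd characteristic this says that the polar form is nondegenerate; in
  characteristic 2 and odd dimension the polar form always has a nonzero radical.
\<close>
definition nondegenerate_quadratic :: "('u::ab_group_add \<Rightarrow> 'f::field) \<Rightarrow> bool" where
  "nondegenerate_quadratic Q \<longleftrightarrow>
     (\<forall>v. Q v = 0 \<and> (\<forall>w. polar_form Q v w = 0) \<longrightarrow> v = 0)"

definition nondegenerate :: "('u::ab_group_add \<Rightarrow> 'u \<Rightarrow> 'f::field) \<Rightarrow> bool" where
  "nondegenerate B \<longleftrightarrow> (\<forall>v. (\<forall>w. B v w = 0) \<longrightarrow> v = 0)"

definition symplectic_form ::
  "('f::field \<Rightarrow> 'u::ab_group_add \<Rightarrow> 'u) \<Rightarrow> ('u \<Rightarrow> 'u \<Rightarrow> 'f) \<Rightarrow> bool" where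
  "symplectic_form scale B \<longleftrightarrow> bilinear_form scale B \<and> (\<forall>v. B v v = 0)"

text \<open>
  Hermitian with respect to the field automorphism \<open>a \<mapsto> a ^ r\<close>; over a field of order
  \<open>r ^ 2\<close> this is the automorphism of order 2.
\<close>
definition hermitian_form ::
  "('f::field \<Rightarrow> 'u::ab_group_add \<Rightarrow> 'u) \<Rightarrow> nat \<Rightarrow> ('u \<Rightarrow> 'u \<Rightarrow> 'f) \<Rightarrow> bool" where
  "hermitian_form scale r H \<longleftrightarrow>
     (\<forall>w. Vector_Spaces.linear scale (*) (\<lambda>v. H v w)) \<and> (\<forall>v w. H w v = H v w ^ r)"

fun vanishes_on :: "('f::field, 'u) form \<Rightarrow> 'u set \<Rightarrow> bool" where
  "vanishes_on (Quadratic Q) W \<longleftrightarrow> (\<forall>w\<in>W. Q w = 0)"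
| "vanishes_on (Symplectic B) W \<longleftrightarrow> (\<forall>v\<in>W. \<forall>w\<in>W. B v w = 0)"
| "vanishes_on (Hermitian H) W \<longleftrightarrow> (\<forall>v\<in>W. \<forall>w\<in>W. H v w = 0)"

definition isotropic ::
  "('f::field \<Rightarrow> 'u::ab_group_add \<Rightarrow> 'u) \<Rightarrow> ('f, 'u) form \<Rightarrow> 'u set \<Rightarrow> bool" where
  "isotropic scale f W \<longleftrightarrow> module.subspace scale W \<and> vanishes_on f W"

definition witt_index ::
  "('f::field \<Rightarrow> 'u::{ab_group_add, finite} \<Rightarrow> 'u) \<Rightarrow> ('f, 'u) form \<Rightarrow> nat" where
  "witt_index scale f = Max (vector_space.dim scale ` {W. isotropic scale f W})"

text \<open>
  The constructors stand for \<open>B\<^sub>D\<close>, \<open>C\<^sub>D\<close>, \<open>D\<^sub>D\<close>, \<open>\<^sup>2D\<close> with index \<open>D + 1\<close>, and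
  \<open>\<^sup>2A\<close> with index \<open>2D\<close> and \<open>2D - 1\<close>.
\<close>
datatype polar_type = Type_B | Type_C | Type_D | Type_2D | Type_2A_even | Type_2A_odd

fun polar_q :: "polar_type \<Rightarrow> nat \<Rightarrow> nat \<Rightarrow> real" where
  "polar_q Type_B p n = real p ^ n"
| "polar_q Type_C p n = real p ^ n"
| "polar_q Type_D p n = real p ^ n"
| "polar_q Type_2D p n = real p ^ n"
| "polar_q Type_2A_even p n = real p ^ (2 * n)"
| "polar_q Type_2A_odd p n = real p ^ (2 * n)"

fun polar_e :: "polar_type \<Rightarrow> real" where
  "polar_e Type_B = 0"
| "polar_e Type_C = 0"
| "polar_e Type_D = - 1"
| "polar_e Type_2D = 1"
| "polar_e Type_2A_even = 1 / 2"
| "polar_e Type_2A_odd = - (1 / 2)"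

definition polar_space ::
  "('f::{field, finite} \<Rightarrow> 'u::{ab_group_add, finite} \<Rightarrow> 'u) \<Rightarrow> polar_type \<Rightarrow> nat \<Rightarrow> nat \<Rightarrow> nat
    \<Rightarrow> ('f, 'u) form \<Rightarrow> bool" where
  "polar_space scale T p n D f \<longleftrightarrow>
     vector_space scale \<and> prime p \<and> n \<ge> 1 \<and> D \<ge> 1 \<and>
     (case T of
        Type_B \<Rightarrow> CARD('f) = p ^ n \<and> vector_space.dim scale (UNIV :: 'u set) = 2 * D + 1 \<and>
          (\<exists>Q. f = Quadratic Q \<and> quadratic_form scale Q \<and> nondegenerate_quadratic Q)
      | Type_C \<Rightarrow> CARD('f) = p ^ n \<and> vector_space.dim scale (UNIV :: 'u set) = 2 * D \<and>
          (\<exists>B. f = Symplectic B \<and> symplectic_form scale B \<and> nondegenerate B)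
      | Type_D \<Rightarrow> CARD('f) = p ^ n \<and> vector_space.dim scale (UNIV :: 'u set) = 2 * D \<and>
          (\<exists>Q. f = Quadratic Q \<and> quadratic_form scale Q \<and> nondegenerate_quadratic Q) \<and>
          witt_index scale f = D
      | Type_2D \<Rightarrow> CARD('f) = p ^ n \<and> vector_space.dim scale (UNIV :: 'u set) = 2 * D + 2 \<and>
          (\<exists>Q. f = Quadratic Q \<and> quadratic_form scale Q \<and> nondegenerate_quadratic Q) \<and>
          witt_index scale f = D
      | Type_2A_even \<Rightarrow>
          CARD('f) = p ^ (2 * n) \<and> vector_space.dim scale (UNIV :: 'u set) = 2 * D + 1 \<and>
          (\<exists>H. f = Hermitian H \<and> hermitian_form scale (p ^ n) H \<and> nondegenerate H)
      | Type_2A_odd \<Rightarrow>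
          CARD('f) = p ^ (2 * n) \<and> vector_space.dim scale (UNIV :: 'u set) = 2 * D \<and>
          (\<exists>H. f = Hermitian H \<and> hermitian_form scale (p ^ n) H \<and> nondegenerate H))"

definition max_isotropics ::
  "('f::field \<Rightarrow> 'u::ab_group_add \<Rightarrow> 'u) \<Rightarrow> ('f, 'u) form \<Rightarrow> 'u set set" where
  "max_isotropics scale f =
     {W. isotropic scale f W \<and> (\<forall>W'. isotropic scale f W' \<and> W \<subseteq> W' \<longrightarrow> W' = W)}"

text \<open>
  For a finite set \<open>X\<close>, the space \<open>\<complex>\<^sup>X\<close> is represented by the functions that vanish outside
  \<open>X\<close>, and matrices with rows and columns indexed by \<open>X\<close> by the binary functions that vanish
  outside \<open>X \<times> X\<close>.
\<close>
definition vecs :: "'v set \<Rightarrow> ('v \<Rightarrow> complex) set" where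
  "vecs X = {v. \<forall>y. y \<notin> X \<longrightarrow> v y = 0}"

definition mats :: "'v set \<Rightarrow> ('v \<Rightarrow> 'v \<Rightarrow> complex) set" where
  "mats X = {M. \<forall>y z. y \<notin> X \<or> z \<notin> X \<longrightarrow> M y z = 0}"

definition mat_vec :: "'v set \<Rightarrow> ('v \<Rightarrow> 'v \<Rightarrow> complex) \<Rightarrow> ('v \<Rightarrow> complex) \<Rightarrow> 'v \<Rightarrow> complex" where
  "mat_vec X M v = (\<lambda>y. \<Sum>z\<in>X. M y z * v z)"

definition eigenspace ::
  "'v set \<Rightarrow> ('v \<Rightarrow> 'v \<Rightarrow> complex) \<Rightarrow> complex \<Rightarrow> ('v \<Rightarrow> complex) set" where
  "eigenspace X M t = {v \<in> vecs X. mat_vec X M v = (\<lambda>y. t * v y)}"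

text \<open>
  For diagonalizable \<open>M\<close>, the primitive idempotent for the eigenvalue \<open>t\<close> is the projection
  onto the eigenspace of \<open>t\<close> along the sum of the other eigenspaces.
\<close>
definition primitive_idempotent ::
  "'v set \<Rightarrow> ('v \<Rightarrow> 'v \<Rightarrow> complex) \<Rightarrow> complex \<Rightarrow> 'v \<Rightarrow> 'v \<Rightarrow> complex" where
  "primitive_idempotent X M t =
     (THE E. E \<in> mats X \<and>
        (\<forall>v \<in> eigenspace X M t. mat_vec X E v = v) \<and>
        (\<forall>s v. s \<noteq> t \<and> v \<in> eigenspace X M s \<longrightarrow> mat_vec X E v = (\<lambda>_. 0)))"

definition std_basis :: "'v \<Rightarrow> 'v \<Rightarrow> complex" where
  "std_basis y = (\<lambda>z. if z = y then 1 else 0)"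

definition dual_polar_adjacency ::
  "('f::field \<Rightarrow> 'u::ab_group_add \<Rightarrow> 'u) \<Rightarrow> ('f, 'u) form \<Rightarrow> nat \<Rightarrow> 'u set \<Rightarrow> 'u set \<Rightarrow> complex"
  where
  "dual_polar_adjacency scale f D y z =
     (if y \<in> max_isotropics scale f \<and> z \<in> max_isotropics scale f \<and>
         vector_space.dim scale (y \<inter> z) = D - 1 then 1 else 0)"

definition dual_polar_a1 :: "real \<Rightarrow> real \<Rightarrow> real" where
  "dual_polar_a1 q e = q powr (e + 1) - 1"

definition dual_polar_theta :: "real \<Rightarrow> real \<Rightarrow> nat \<Rightarrow> nat \<Rightarrow> real" where
  "dual_polar_theta q e D i =
     ((dual_polar_a1 q e + 1) * q ^ (D - i) - q ^ i - dual_polar_a1 q e) / (q - 1)"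

definition dual_polar_theta_star :: "real \<Rightarrow> real \<Rightarrow> nat \<Rightarrow> nat \<Rightarrow> real" where
  "dual_polar_theta_star q e D i =
     (q powr (real D + e) + q) / (q powr e + 1) *
     ((q powr (- real i) * (q powr (real D + e) + 1) - q powr e - 1) / (q - 1))"

definition dual_polar_idempotent ::
  "('f::field \<Rightarrow> 'u::ab_group_add \<Rightarrow> 'u) \<Rightarrow> ('f, 'u) form \<Rightarrow> real \<Rightarrow> real \<Rightarrow> nat \<Rightarrow> nat
    \<Rightarrow> 'u set \<Rightarrow> 'u set \<Rightarrow> complex" where
  "dual_polar_idempotent scale f q e D i =
     primitive_idempotent (max_isotropics scale f) (dual_polar_adjacency scale f D)
       (complex_of_real (dual_polar_theta q e D i))"

definition dual_polar_dual_adjacency ::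
  "('f::field \<Rightarrow> 'u::ab_group_add \<Rightarrow> 'u) \<Rightarrow> ('f, 'u) form \<Rightarrow> real \<Rightarrow> real \<Rightarrow> nat \<Rightarrow> 'u set
    \<Rightarrow> 'u set \<Rightarrow> 'u set \<Rightarrow> complex" where
  "dual_polar_dual_adjacency scale f q e D x y z =
     (if y \<in> max_isotropics scale f \<and> z = y
      then of_nat (card (max_isotropics scale f)) * dual_polar_idempotent scale f q e D 1 x y
      else 0)"

definition subspaces_of ::
  "('f::field \<Rightarrow> 'u::ab_group_add \<Rightarrow> 'u) \<Rightarrow> 'u set \<Rightarrow> 'u set set" where
  "subspaces_of scale x = {W. module.subspace scale W \<and> W \<subseteq> x}"

definition eta_N :: "'u set set \<Rightarrow> 'u set \<Rightarrow> 'u set \<Rightarrow> 'u set \<Rightarrow> complex" where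
  "eta_N X x \<eta> = (\<lambda>z. \<Sum>y \<in> {y \<in> X. x \<inter> y = \<eta>}. std_basis y z)"

end

theory Submission
  imports Defs "HOL-Computational_Algebra.Polynomial"
begin

text \<open>
  All the polar spaces are treated at once through a reflexive form \<open>B\<close>, a notion of singular
  vector, and the number \<open>s\<close> of singular vectors on a line \<open>v + \<langle>m\<rangle>\<close> with \<open>m\<close> singular and not
  orthogonal to \<open>v\<close>: \<open>s\<close> is \<open>1\<close> for quadratic forms, the order \<open>q\<close> of the field for symplectic
  forms and \<open>\<surd>q\<close> for Hermitian forms. An isotropic subspace of dimension \<open>D - 1\<close> lies in exactly
  \<open>t + 1\<close> maximal isotropic subspaces, where \<open>t = s q\<^bsup>N - 2D\<^esup> = q\<^bsup>e + 1\<^esup>\<close> and \<open>N\<close> is the dimension of the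
  whole space; all but one of them meet a given maximal isotropic \<open>x\<close> in the same subspace. The
  formula for \<open>A \<eta>\<^sup>\<N>\<close> follows by counting.

  For the dual adjacency matrix, let \<open>N\<^sub>k\<close> send a vector \<open>v\<close> to the sums of \<open>v\<close> over the maximal
  isotropics through each isotropic \<open>k\<close>-space. If \<open>N\<^sub>j v = 0\<close> for all \<open>j < k\<close>, then
  \<open>N\<^sub>k A v = \<theta>\<^sub>k N\<^sub>k v\<close>. The resulting filtration shows that \<open>A\<close> is diagonalizable with eigenvalues
  \<open>\<theta>\<^sub>0, \<dots>, \<theta>\<^sub>D\<close>, and that an eigenvector for \<open>\<theta>\<^sub>1\<close> is determined by its image under \<open>N\<^sub>1\<close>. Hence
  \<open>E\<^sub>1\<close> is a linear combination of \<open>N\<^sub>1\<^sup>T N\<^sub>1\<close> and the all-ones matrix, and its \<open>(x, y)\<close>-entry is an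
  affine function of the order of \<open>x \<inter> y\<close>.
\<close>

section \<open>Finite vector spaces and orthogonality\<close>

lemma card_eq_sum_fibers:
  assumes "finite A" "finite C" "\<And>a. a \<in> A \<Longrightarrow> f a \<in> C"
  shows "card A = (\<Sum>c\<in>C. card {a \<in> A. f a = c})"
proof -
  have "card A = (\<Sum>c\<in>C. sum (\<lambda>_. 1) {a \<in> A. f a = c})"
    using assms by (subst sum.group) auto
  then show ?thesis by simp
qed

locale finite_vector_space = vector_space scale
  for scale :: "'f::{field, finite} \<Rightarrow> 'u::{ab_group_add, finite} \<Rightarrow> 'u" (infixr \<open>*s\<close> 75)
begin

sublocale finite_dimensional_vector_space scale "SOME C. independent C \<and> span C = UNIV"
proof -
  obtain C where "independent C" "span C = (UNIV :: 'u set)"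
    by (metis basis_exists top.extremum_uniqueI)
  then have "independent (SOME C. independent C \<and> span C = (UNIV :: 'u set)) \<and>
      span (SOME C. independent C \<and> span C = (UNIV :: 'u set)) = UNIV"
    by (intro someI[of "\<lambda>C. independent C \<and> span C = (UNIV :: 'u set)" C]) simp
  then show "finite_dimensional_vector_space scale (SOME C. independent C \<and> span C = UNIV)"
    by unfold_locales simp_all
qed

declare dim_UNIV [simp del]

text \<open>Adjoining an independent vector \<open>a\<close> multiplies the order by that of the
  field, because \<open>(k, y) \<mapsto> k *s a + y\<close> is a bijection onto the larger
  span.\<close>

lemma card_span_independent:
  assumes "independent C"
  shows "card (span C) = CARD('f) ^ card C"
proof -
  have "finite C" by simp
  then show ?thesis
    using assms
  proof (induction C rule: finite_induct)
    case empty
    then show ?case by simp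
  next
    case (insert a S)
    have ind: "independent S" and a: "a \<notin> span S"
      using insert by (auto simp: independent_insert)
    let ?f = "\<lambda>(k, y). k *s a + y"
    have "inj_on ?f (UNIV \<times> span S)"
    proof (rule inj_onI, clarsimp)
      fix k l y z
      assume y: "y \<in> span S" and z: "z \<in> span S" and eq: "k *s a + y = l *s a + z"
      have "(k - l) *s a = z - y"
        using eq by (simp add: scale_left_diff_distrib algebra_simps)
      then have "(k - l) *s a \<in> span S"
        using y z by (simp add: span_diff)
      then have "k - l = 0"
        using a by (metis span_scale scale_scale left_inverse scale_one)
      then show "k = l \<and> y = z"
        using eq by simp
    qed
    moreover have "?f ` (UNIV \<times> span S) = span (insert a S)"
    proof -
      have "(\<exists>k y. y \<in> span S \<and> x = k *s a + y) \<longleftrightarrow> (\<exists>k. x - k *s a \<in> span S)" for x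
        by (metis add_diff_cancel_left' add.commute diff_add_cancel)
      then have "x \<in> ?f ` (UNIV \<times> span S) \<longleftrightarrow> (\<exists>k. x - k *s a \<in> span S)" for x
        by (auto simp: image_iff Bex_def)
      then show ?thesis
        unfolding span_insert by blast
    qed
    ultimately have "card (span (insert a S)) = CARD('f) * card (span S)"
      by (metis card_image card_cartesian_product)
    then show ?case
      using insert ind by simp
  qed
qed

lemma card_subspace:
  assumes "subspace W"
  shows "card W = CARD('f) ^ dim W"
  by (metis assms basis_exists card_span_independent span_subspace)

lemma card_field_ge_2: "CARD('f) \<ge> 2"
proof -
  have "card {0, 1 :: 'f} \<le> CARD('f)"
    by (rule card_mono) auto
  then show ?thesis by simp
qed

lemma dim_span_insert:
  assumes "subspace S" "v \<notin> S"
  shows "dim (span (insert v S)) = dim S + 1"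
  using assms by (simp add: dim_insert span_eq_iff[THEN iffD2])

lemma span_insert_least:
  "subspace T \<Longrightarrow> v \<in> T \<Longrightarrow> S \<subseteq> T \<Longrightarrow> span (insert v S) \<subseteq> T"
  by (rule span_minimal) auto

definition hyperplane :: "'u set \<Rightarrow> 'u set \<Rightarrow> bool" where
  "hyperplane T S \<longleftrightarrow> subspace T \<and> T \<subseteq> S \<and> dim S = dim T + 1"

lemma hyperplaneD:
  assumes "hyperplane T S"
  shows "subspace T" "T \<subseteq> S" "dim S = dim T + 1"
  using assms by (simp_all add: hyperplane_def)

lemma hyperplane_span_insert:
  assumes "hyperplane T S" "subspace S" "v \<in> S" "v \<notin> T"
  shows "span (insert v T) = S"
proof (rule subspace_dim_equal)
  show "span (insert v T) \<subseteq> S"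
    using assms by (intro span_insert_least) (auto simp: hyperplane_def)
  show "dim S \<le> dim (span (insert v T))"
    using dim_span_insert[of T v] assms by (simp add: hyperplane_def)
qed (use assms in auto)

text \<open>The sum of \<open>S\<close> and \<open>H\<close> is all of \<open>z\<close>, because it
  strictly contains the hyperplane \<open>H\<close>; the dimension formula for sums does the
  rest.\<close>

lemma hyperplane_Int:
  assumes H: "hyperplane H z" and z: "subspace z" and S: "subspace S" "S \<subseteq> z" "\<not> S \<subseteq> H"
  shows "hyperplane (S \<inter> H) S"
proof -
  note Hs = hyperplaneD[OF H]
  let ?U = "{x + y |x y. x \<in> S \<and> y \<in> H}"
  have sum: "dim ?U + dim (S \<inter> H) = dim S + dim H"
    using dim_sums_Int[OF S(1) Hs(1)] .
  have subU: "subspace ?U"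
    by (rule subspace_sums[OF S(1) Hs(1)])
  have "?U \<subseteq> z"
    using S Hs z by (auto intro!: subspace_add)
  then have 1: "dim ?U \<le> dim H + 1"
    using dim_subset[of ?U z] Hs(3) by simp
  have HU: "H \<subseteq> ?U"
  proof
    fix y assume "y \<in> H"
    then show "y \<in> ?U"
      using subspace_0[OF S(1)] by force
  qed
  obtain a where a: "a \<in> S" "a \<notin> H" using S by auto
  have "a \<in> ?U"
    using a subspace_0[OF Hs(1)] by force
  then have "H \<noteq> ?U" using a by auto
  then have "dim ?U > dim H"
    using HU subspace_dim_equal[OF Hs(1) subU] by force
  then have "dim S = dim (S \<inter> H) + 1"
    using 1 sum by linarith
  then show ?thesis
    using S Hs by (simp add: hyperplane_def subspace_inter)
qed

text \<open>The Gaussian number (q^k - 1)/(q - 1), with q the order of the field: it counts the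
  points, and also the hyperplanes, of a \<open>k\<close>-dimensional space.\<close>

definition gauss :: "nat \<Rightarrow> nat" where
  "gauss k = (\<Sum>j<k. CARD('f) ^ j)"

lemma gauss_mult: "gauss k * (CARD('f) - 1) = CARD('f) ^ k - 1"
proof -
  have "gauss k * (CARD('f) - 1) + 1 = CARD('f) ^ k"
  proof (induction k)
    case (Suc k)
    have "gauss (Suc k) * (CARD('f) - 1) + 1
        = CARD('f) ^ k * (CARD('f) - 1) + (gauss k * (CARD('f) - 1) + 1)"
      by (simp add: gauss_def algebra_simps)
    also have "\<dots> = CARD('f) ^ k * (CARD('f) - 1 + 1)"
      by (simp only: Suc) (simp only: distrib_left mult_1_right)
    also have "\<dots> = CARD('f) ^ Suc k"
      using card_field_ge_2 by simp
    finally show ?case .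
  qed (simp add: gauss_def)
  then show ?thesis by linarith
qed

lemma gauss_simps: "gauss 0 = 0" "gauss (Suc k) = gauss k + CARD('f) ^ k"
  by (simp_all add: gauss_def)

lemma real_gauss: "real (gauss k) = (real CARD('f) ^ k - 1) / (real CARD('f) - 1)"
proof -
  have "real CARD('f) \<noteq> 1" using card_field_ge_2 by linarith
  then show ?thesis by (simp add: gauss_def geometric_sum)
qed

end

section \<open>Reflexive forms and orthogonality\<close>

locale polar_geometry = finite_vector_space scale
  for scale :: "'f::{field, finite} \<Rightarrow> 'u::{ab_group_add, finite} \<Rightarrow> 'u" (infixr \<open>*s\<close> 75) +
  fixes B :: "'u \<Rightarrow> 'u \<Rightarrow> 'f" and sing :: "'u \<Rightarrow> bool" and s :: nat
  \<comment> \<open>Linearity is asked in the first argument only, so that Hermitian forms are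
    covered; reflexivity transfers orthogonality to the other side.\<close>
  assumes B_add: "B (v + w) u = B v u + B w u"
    and B_scale: "B (a *s v) u = a * B v u"
    and B_refl: "B v w = 0 \<Longrightarrow> B w v = 0"
    and sing_0: "sing 0"
    and sing_scale: "sing v \<Longrightarrow> sing (a *s v)"
    and sing_add: "sing v \<Longrightarrow> sing w \<Longrightarrow> B v w = 0 \<Longrightarrow> sing (v + w)"
    and sing_B: "sing v \<Longrightarrow> B v v = 0"
    \<comment> \<open>Only singular vectors are tested, since in characteristic 2 and odd dimension
      the polar form of a nondegenerate quadratic form has a nonzero radical.\<close>
    and nondeg: "sing v \<Longrightarrow> (\<And>w. B w v = 0) \<Longrightarrow> v = 0"
    and sing_count: "sing m \<Longrightarrow> B v m \<noteq> 0 \<Longrightarrow> card {a. sing (v + a *s m)} = s"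
begin

lemma B_0: "B 0 u = 0"
  using B_scale[of 0 0 u] by simp

lemma B_0_right: "B u 0 = 0"
  by (rule B_refl[OF B_0])

definition perp :: "'u set \<Rightarrow> 'u set" where
  "perp S = {v. \<forall>w\<in>S. B v w = 0}"

lemma subspace_perp: "subspace (perp S)"
  by (simp add: perp_def subspace_def B_0 B_add B_scale)

lemma perp_antimono: "S \<subseteq> T \<Longrightarrow> perp T \<subseteq> perp S"
  by (auto simp: perp_def)

lemma subset_perp_commute: "S \<subseteq> perp T \<longleftrightarrow> T \<subseteq> perp S"
  by (auto simp: perp_def intro: B_refl)

text \<open>The Galois connection \<open>subset_perp_commute\<close>, with \<open>perp\<close>
  always a subspace, stands in for linearity in the second argument.\<close>

lemma perp_span: "perp (span S) = perp S"
proof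
  show "perp (span S) \<subseteq> perp S"
    by (simp add: perp_antimono span_superset)
  have "S \<subseteq> perp (perp S)"
    using subset_perp_commute[of S "perp S"] by simp
  then have "span S \<subseteq> perp (perp S)"
    by (simp add: span_minimal subspace_perp)
  then show "perp S \<subseteq> perp (span S)"
    using subset_perp_commute[of "span S" "perp S"] by simp
qed

text \<open>\<open>perp {u}\<close> is the kernel of the functional
  \<open>\<lambda>v. B v u\<close>; subtracting \<open>(B v u / B w u) *s w\<close> moves any
  \<open>v\<close> of \<open>W\<close> into it.\<close>

lemma hyperplane_perp_singleton:
  assumes W: "subspace W" and w: "w \<in> W" "B w u \<noteq> 0"
  shows "hyperplane (W \<inter> perp {u}) W"
proof -
  let ?K = "W \<inter> perp {u}"
  have K: "subspace ?K" by (simp add: W subspace_inter subspace_perp)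
  have wK: "w \<notin> ?K" using w by (simp add: perp_def)
  have "W \<subseteq> span (insert w ?K)"
  proof
    fix v assume v: "v \<in> W"
    let ?k = "B v u / B w u"
    have "v - ?k *s w \<in> W"
      using v w W by (simp add: subspace_diff subspace_scale)
    moreover have "B (v - ?k *s w) u = 0"
      using B_add[of v "(- ?k) *s w" u] B_scale[of "- ?k" w u] w by simp
    ultimately have "v - ?k *s w \<in> span ?K"
      by (simp add: perp_def span_base)
    then show "v \<in> span (insert w ?K)"
      by (auto simp: span_insert)
  qed
  then have "span (insert w ?K) = W"
    using w by (intro subset_antisym span_insert_least W) auto
  then show ?thesis
    using dim_span_insert[OF K wK] K by (simp add: hyperplane_def)
qed

lemma dim_Int_perp_singleton:
  assumes "subspace W"
  shows "dim W \<le> dim (W \<inter> perp {u}) + 1"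
proof (cases "W \<subseteq> perp {u}")
  case True
  then have "W \<inter> perp {u} = W" by auto
  then show ?thesis by simp
next
  case False
  then obtain w where "w \<in> W" "B w u \<noteq> 0" by (auto simp: perp_def)
  from hyperplane_perp_singleton[OF assms this] show ?thesis
    by (simp add: hyperplane_def)
qed

lemma dim_Int_perp_card:
  assumes "subspace W"
  shows "dim W \<le> dim (W \<inter> perp C) + card C"
proof -
  have "finite C" by simp
  then show ?thesis
  proof (induction C rule: finite_induct)
    case empty
    then show ?case by (simp add: perp_def)
  next
    case (insert c C)
    have "W \<inter> perp (insert c C) = (W \<inter> perp C) \<inter> perp {c}"
      by (auto simp: perp_def)
    then have "dim (W \<inter> perp C) \<le> dim (W \<inter> perp (insert c C)) + 1"
      using dim_Int_perp_singleton[of "W \<inter> perp C" c] assms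
      by (simp add: subspace_inter subspace_perp)
    then show ?case using insert by simp
  qed
qed

text \<open>A basis of \<open>W \<inter> S\<close> imposes no condition on \<open>W\<close>, so only
  the \<open>dim S - dim (W \<inter> S)\<close> further basis vectors of \<open>S\<close> can lower
  the dimension, each by at most one.\<close>

lemma dim_Int_perp:
  assumes W: "subspace W" and S: "subspace S" and WS: "W \<subseteq> perp (W \<inter> S)"
  shows "dim W + dim (W \<inter> S) \<le> dim (W \<inter> perp S) + dim S"
proof -
  obtain C where C: "C \<subseteq> W \<inter> S" "independent C" "W \<inter> S \<subseteq> span C" "card C = dim (W \<inter> S)"
    by (rule basis_exists)
  obtain C' where C': "C \<subseteq> C'" "C' \<subseteq> S" "independent C'" "S \<subseteq> span C'"
    using maximal_independent_subset_extend[of C S] C by auto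
  have "span C' = S"
    by (rule span_subspace) (use C' S in auto)
  then have pS: "perp S = perp C'" and dS: "dim S = card C'"
    using perp_span[of C'] dim_span_eq_card_independent[OF C'(3)] by auto
  have "W \<subseteq> perp C"
    using WS perp_antimono[OF C(1)] by auto
  then have "W \<inter> perp (C' - C) \<subseteq> W \<inter> perp C'"
    by (auto simp: perp_def)
  then have "dim (W \<inter> perp (C' - C)) \<le> dim (W \<inter> perp S)"
    unfolding pS by (rule dim_subset)
  moreover have "card (C' - C) + dim (W \<inter> S) = dim S"
    using C' C dS by (metis card_Diff_subset card_mono finite le_add_diff_inverse2)
  ultimately show ?thesis
    using dim_Int_perp_card[OF W, of "C' - C"] by linarith
qed

section \<open>Isotropic subspaces\<close>

definition iso :: "'u set \<Rightarrow> bool" where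
  "iso W \<longleftrightarrow> subspace W \<and> (\<forall>v\<in>W. sing v) \<and> W \<subseteq> perp W"

lemma isoD:
  assumes "iso W"
  shows "subspace W" "v \<in> W \<Longrightarrow> sing v" "W \<subseteq> perp W"
  using assms by (auto simp: iso_def)

lemma iso_subspace: "iso W \<Longrightarrow> subspace T \<Longrightarrow> T \<subseteq> W \<Longrightarrow> iso T"
  unfolding iso_def perp_def by blast

lemma iso_0: "iso {0}"
  by (simp add: iso_def sing_0 perp_def B_0)

lemma iso_span_insert:
  assumes S: "iso S" and v: "sing v" "v \<in> perp S"
  shows "iso (span (insert v S))"
proof -
  have "span (insert v S) \<subseteq> perp (insert v S)"
    using S v sing_B[OF v(1)] subset_perp_commute[of S "{v}"]
    by (intro span_insert_least subspace_perp) (auto simp: iso_def perp_def)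
  moreover have "sing w" if w: "w \<in> span (insert v S)" for w
  proof -
    obtain k where k: "w - k *s v \<in> span S"
      using w by (auto simp: span_insert)
    then have kS: "w - k *s v \<in> S"
      using isoD(1)[OF S] by (simp add: span_eq_iff[THEN iffD2])
    have "B (k *s v) (w - k *s v) = 0"
      using v kS by (simp add: B_scale perp_def)
    then have "sing (k *s v + (w - k *s v))"
      using sing_scale[OF v(1)] isoD(2)[OF S kS] by (intro sing_add)
    then show ?thesis by simp
  qed
  ultimately show ?thesis
    by (simp add: iso_def perp_span)
qed

lemma iso_span_singleton: "sing v \<Longrightarrow> iso (span {v})"
  using iso_span_insert[OF iso_0, of v] by (simp add: perp_def B_0_right insert_commute)

text \<open>Double counting of the orthogonal pairs in \<open>UNIV \<times> W\<close>.\<close>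

lemma dim_perp:
  assumes W: "iso W"
  shows "dim (perp W) + dim W = dim (UNIV :: 'u set)"
proof -
  let ?q = "CARD('f)" and ?N = "dim (UNIV :: 'u set)"
  let ?R = "{(u, w). w \<in> W \<and> B u w = 0}"
  note sW = isoD(1)[OF W]
  have q2: "?q \<ge> 2" by (rule card_field_ge_2)
  \<comment> \<open>A nonzero \<open>w\<close> in \<open>W\<close> is singular, hence not in the
    radical, so \<open>perp {w}\<close> has codimension one. The factor \<open>?q\<close> avoids the
    exponent \<open>?N - 1\<close>.\<close>
  have c1: "?q * card {u. B u w = 0} = ?q ^ ?N" if w: "w \<in> W - {0}" for w
  proof -
    obtain u where u: "B u w \<noteq> 0"
      using nondeg[of w] isoD(2)[OF W, of w] w by auto
    have "hyperplane (UNIV \<inter> perp {w}) UNIV"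
      by (rule hyperplane_perp_singleton) (use u in auto)
    then show ?thesis
      using card_subspace[of "perp {w}"]
      by (simp add: hyperplane_def perp_def)
  qed
  have c2: "?q * card {w \<in> W. B u w = 0} = (if u \<in> perp W then ?q * ?q ^ dim W else ?q ^ dim W)"
    for u
  proof (cases "u \<in> perp W")
    case True
    then have "{w \<in> W. B u w = 0} = W" by (auto simp: perp_def)
    then show ?thesis using True card_subspace[OF sW] by simp
  next
    case False
    then obtain w where w: "w \<in> W" "B u w \<noteq> 0" by (auto simp: perp_def)
    then have "B w u \<noteq> 0" using B_refl by blast
    then have h: "hyperplane (W \<inter> perp {u}) W"
      by (rule hyperplane_perp_singleton[OF sW w(1)])
    have "{w \<in> W. B u w = 0} = W \<inter> perp {u}"
      by (auto simp: perp_def intro: B_refl)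
    then show ?thesis
      using False h card_subspace[of "W \<inter> perp {u}"] by (simp add: hyperplane_def)
  qed
  have "?R = (SIGMA u:UNIV. {w \<in> W. B u w = 0})"
    by auto
  then have "card ?R = (\<Sum>u\<in>UNIV. card {w \<in> W. B u w = 0})"
    by (simp add: card_SigmaI)
  then have "?q * card ?R = (\<Sum>u\<in>UNIV. if u \<in> perp W then ?q * ?q ^ dim W else ?q ^ dim W)"
    by (simp add: sum_distrib_left c2)
  also have "\<dots> = card (perp W) * (?q * ?q ^ dim W) + card (- perp W) * ?q ^ dim W"
    by (simp add: sum.If_cases)
  finally have e1: "?q * card ?R = card (perp W) * (?q * ?q ^ dim W) + card (- perp W) * ?q ^ dim W" .
  have "card ?R = card (SIGMA w:W. {u. B u w = 0})"
    by (rule bij_betw_same_card[of "\<lambda>(u, w). (w, u)"]) (auto simp: bij_betw_def inj_on_def image_iff)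
  also have "\<dots> = (\<Sum>w\<in>W. card {u. B u w = 0})"
    by (simp add: card_SigmaI)
  also have "\<dots> = card {u. B u 0 = 0} + (\<Sum>w\<in>W - {0}. card {u. B u w = 0})"
    by (rule sum.remove) (auto simp: subspace_0[OF sW])
  finally have "?q * card ?R = ?q * CARD('u) + (\<Sum>w\<in>W - {0}. ?q ^ ?N)"
    by (simp add: sum_distrib_left distrib_left c1 B_0_right)
  also have "\<dots> = ?q * ?q ^ ?N + (card W - 1) * ?q ^ ?N"
    using card_subspace[OF subspace_UNIV] by (simp add: subspace_0[OF sW])
  finally have e2: "?q * card ?R = ?q * ?q ^ ?N + (card W - 1) * ?q ^ ?N" .
  \<comment> \<open>Over the integers, equating the two counts leaves
    \<open>(?q - 1) * (?a * ?b) = (?q - 1) * ?n\<close>.\<close>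
  let ?a = "int (?q ^ dim (perp W))" and ?b = "int (?q ^ dim W)" and ?n = "int (?q ^ ?N)"
  have cP: "int (card (- perp W)) = ?n - ?a"
    using card_subspace[OF subspace_perp, of W] card_subspace[OF subspace_UNIV]
    by (simp add: card_Diff_subset Compl_eq_Diff_UNIV of_nat_diff card_mono)
       (metis card_mono finite of_nat_diff of_nat_power subset_UNIV)
  have "int (card W - 1) = ?b - 1"
    using card_subspace[OF sW] q2 by (simp add: of_nat_diff)
  then have "int ?q * int (card ?R) = int ?q * ?n + (?b - 1) * ?n"
    using arg_cong[OF e2, of int] by simp
  moreover have "int ?q * int (card ?R) = ?a * (int ?q * ?b) + (?n - ?a) * ?b"
    using arg_cong[OF e1, of int] cP card_subspace[OF subspace_perp, of W] by simp
  ultimately have "(int ?q - 1) * (?a * ?b) = (int ?q - 1) * ?n"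
    by (simp only: ring_distribs) (simp add: algebra_simps)
  then have "?a * ?b = ?n"
    using q2 by simp
  then have "int (?q ^ (dim (perp W) + dim W)) = int (?q ^ ?N)"
    by (simp add: power_add)
  then have "?q ^ (dim (perp W) + dim W) = ?q ^ ?N"
    using of_nat_eq_iff by blast
  then show ?thesis
    using q2 power_inject_exp[of ?q] by simp
qed

lemma dim_iso_le:
  assumes "iso W"
  shows "2 * dim W \<le> dim (UNIV :: 'u set)"
  using dim_perp[OF assms] dim_subset[OF isoD(3)[OF assms]] by linarith

text \<open>
  The hyperplanes of an isotropic \<open>z\<close> are the sets \<open>z \<inter> perp {u}\<close> with \<open>u \<notin> perp z\<close>, and
  \<open>H = z \<inter> perp {u}\<close> exactly for \<open>u \<in> perp H - perp z\<close>.
\<close>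

lemma card_hyperplanes_containing:
  assumes z: "iso z" and S: "subspace S" "S \<subseteq> z"
  shows "card {H. hyperplane H z \<and> S \<subseteq> H} = gauss (dim z - dim S)"
proof -
  let ?q = "CARD('f)" and ?N = "dim (UNIV :: 'u set)"
  let ?P = "perp S - perp z" and ?\<H> = "{H. hyperplane H z \<and> S \<subseteq> H}"
  note sz = isoD(1)[OF z]
  have q2: "?q \<ge> 2" by (rule card_field_ge_2)
  have kj: "dim S \<le> dim z" by (rule dim_subset[OF S(2)])
  have kN: "2 * dim z \<le> ?N" by (rule dim_iso_le[OF z])
  have dS: "dim (perp S) = ?N - dim S"
    using dim_perp[OF iso_subspace[OF z S]] by linarith
  have dz: "dim (perp z) = ?N - dim z"
    using dim_perp[OF z] by linarith
  have hyp: "z \<inter> perp {u} \<in> ?\<H>" if u: "u \<in> ?P" for u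
  proof -
    obtain w where w: "w \<in> z" "B u w \<noteq> 0" using u by (auto simp: perp_def)
    then have "B w u \<noteq> 0" using B_refl by blast
    then have "hyperplane (z \<inter> perp {u}) z"
      by (rule hyperplane_perp_singleton[OF sz w(1)])
    moreover have "S \<subseteq> perp {u}"
      using u by (subst subset_perp_commute) simp
    ultimately show ?thesis using S by simp
  qed
  have fib: "{u \<in> ?P. z \<inter> perp {u} = H} = perp H - perp z" if H: "H \<in> ?\<H>" for H
  proof (rule set_eqI, rule iffI)
    fix u assume "u \<in> {u \<in> ?P. z \<inter> perp {u} = H}"
    then show "u \<in> perp H - perp z"
      using subset_perp_commute[of "{u}" H] by auto
  next
    fix u assume u: "u \<in> perp H - perp z"
    have "u \<in> perp S" using H perp_antimono[of S H] u by auto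
    moreover have uP: "u \<in> ?P" using u calculation by auto
    moreover have "H \<subseteq> z \<inter> perp {u}"
      using u H subset_perp_commute[of "{u}" H] by (auto simp: hyperplane_def)
    then have "H = z \<inter> perp {u}"
      using hyp[OF uP] H by (intro subspace_dim_equal) (auto simp: hyperplane_def)
    ultimately show "u \<in> {u \<in> ?P. z \<inter> perp {u} = H}" by auto
  qed
  have cfib: "card (perp H - perp z) = ?q ^ (?N - dim z) * (?q - 1)" if H: "H \<in> ?\<H>" for H
  proof -
    have Hh: "subspace H" "H \<subseteq> z" "dim z = dim H + 1"
      using H by (auto simp: hyperplane_def)
    have "dim (perp H) = Suc (?N - dim z)"
      using dim_perp[OF iso_subspace[OF z Hh(1,2)]] Hh kN by linarith
    moreover have "perp z \<subseteq> perp H" by (rule perp_antimono[OF Hh(2)])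
    ultimately show ?thesis
      using card_subspace[OF subspace_perp] dz
      by (simp add: card_Diff_subset diff_mult_distrib diff_mult_distrib2 mult.commute)
  qed
  have "card ?P = (\<Sum>H\<in>?\<H>. card {u \<in> ?P. z \<inter> perp {u} = H})"
    using hyp by (intro card_eq_sum_fibers) auto
  also have "\<dots> = (\<Sum>H\<in>?\<H>. ?q ^ (?N - dim z) * (?q - 1))"
    using fib cfib by (intro sum.cong) auto
  finally have 1: "card ?P = card ?\<H> * (?q ^ (?N - dim z) * (?q - 1))"
    by simp
  have "?N - dim S = (?N - dim z) + (dim z - dim S)"
    using kj kN by linarith
  then have "card ?P = ?q ^ (?N - dim z) * (?q ^ (dim z - dim S) - 1)"
    using card_subspace[OF subspace_perp] dz dS perp_antimono[OF S(2)]
    by (simp add: card_Diff_subset diff_mult_distrib2 power_add)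
  with 1 have "card ?\<H> * (?q - 1) = ?q ^ (dim z - dim S) - 1"
    using q2 by (simp add: mult.left_commute)
  then have "card ?\<H> * (?q - 1) = gauss (dim z - dim S) * (?q - 1)"
    by (simp only: gauss_mult)
  then show ?thesis
    using q2 by simp
qed

section \<open>Generators, the maximal isotropic subspaces\<close>

definition gens :: "'u set set" where
  "gens = {W. iso W \<and> (\<forall>W'. iso W' \<and> W \<subseteq> W' \<longrightarrow> W' = W)}"

lemma gens_iso: "M \<in> gens \<Longrightarrow> iso M"
  by (simp add: gens_def)

lemma gens_subspace: "M \<in> gens \<Longrightarrow> subspace M"
  by (simp add: gens_iso isoD)

lemma gens_absorb:
  assumes M: "M \<in> gens" and v: "sing v" "v \<in> perp M"
  shows "v \<in> M"
proof -
  have "iso (span (insert v M))"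
    by (rule iso_span_insert[OF gens_iso[OF M] v])
  moreover have "M \<subseteq> span (insert v M)"
    by (meson order_trans span_superset subset_insertI)
  ultimately have "span (insert v M) = M"
    using M by (simp add: gens_def)
  then show ?thesis
    by (metis insertI1 span_base)
qed

text \<open>If \<open>M'\<close> were larger, \<open>M' \<inter> perp M\<close> would be strictly
  larger than \<open>M' \<inter> M\<close>, although maximality of \<open>M\<close> absorbs every
  singular vector of \<open>perp M\<close>.\<close>

lemma dim_iso_le_gens:
  assumes M: "M \<in> gens" and M': "iso M'"
  shows "dim M' \<le> dim M"
proof (rule ccontr)
  assume less: "\<not> ?thesis"
  note sM = gens_subspace[OF M] and sM' = isoD(1)[OF M']
  have "dim M' + dim (M' \<inter> M) \<le> dim (M' \<inter> perp M) + dim M"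
    using isoD(3)[OF M'] perp_antimono[of "M' \<inter> M" M'] by (intro dim_Int_perp sM sM') auto
  moreover have "M' \<inter> perp M \<subseteq> M' \<inter> M"
    using gens_absorb[OF M] isoD(2)[OF M'] by auto
  then have "dim (M' \<inter> perp M) \<le> dim (M' \<inter> M)" by (rule dim_subset)
  ultimately show False using less by linarith
qed

lemma iso_extend:
  assumes "iso S"
  obtains M where "M \<in> gens" "S \<subseteq> M"
proof -
  have "finite {W. iso W}" by simp
  then obtain M where "M \<in> {W. iso W}" "S \<subseteq> M" "\<forall>W\<in>{W. iso W}. M \<subseteq> W \<longrightarrow> M = W"
    using finite_has_maximal2[of "{W. iso W}" S] assms by auto
  then show ?thesis
    using that[of M] by (auto simp: gens_def)
qed

end

section \<open>Counting maximal isotropic subspaces\<close>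

locale polar_rank = polar_geometry scale B sing s
  for scale :: "'f::{field, finite} \<Rightarrow> 'u::{ab_group_add, finite} \<Rightarrow> 'u" (infixr \<open>*s\<close> 75)
    and B :: "'u \<Rightarrow> 'u \<Rightarrow> 'f" and sing :: "'u \<Rightarrow> bool" and s :: nat +
  fixes D :: nat
  assumes dim_gens: "M \<in> gens \<Longrightarrow> dim M = D"
    and D_pos: "1 \<le> D"
begin

text \<open>The truncated subtraction is exact, as a generator of dimension \<open>D\<close> forces
  the whole space to have dimension at least \<open>2 * D\<close>.\<close>

definition t :: nat where
  "t = s * CARD('f) ^ (dim (UNIV :: 'u set) - 2 * D)"

lemma iso_dim_gens:
  assumes "iso M" "dim M = D"
  shows "M \<in> gens"
proof -
  obtain M' where M': "M' \<in> gens" "M \<subseteq> M'"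
    using iso_extend[OF assms(1)] by blast
  then have "M = M'"
    using assms dim_gens[OF M'(1)] gens_subspace[OF M'(1)] isoD(1)[OF assms(1)]
    by (intro subspace_dim_equal) auto
  then show ?thesis using M' by simp
qed

lemma gens_eq: "y \<in> gens \<Longrightarrow> z \<in> gens \<Longrightarrow> y \<subseteq> z \<Longrightarrow> y = z"
  by (simp add: dim_gens gens_subspace subspace_dim_equal)

lemma span_insert_gens:
  assumes "iso H" "dim H + 1 = D" "sing v" "v \<in> perp H" "v \<notin> H"
  shows "span (insert v H) \<in> gens"
  using assms dim_span_insert[OF isoD(1)] iso_span_insert by (intro iso_dim_gens) auto

text \<open>
  Fix \<open>M \<in> gens\<close> through \<open>H\<close> and \<open>m \<in> M - H\<close>. Among the vectors of \<open>perp H - perp M\<close>, every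
  line in direction \<open>m\<close> carries exactly \<open>s\<close> singular vectors.
\<close>

lemma card_gens_containing:
  assumes H: "iso H" "dim H + 1 = D"
  shows "card {y \<in> gens. H \<subseteq> y} = t + 1"
proof -
  let ?q = "CARD('f)" and ?N = "dim (UNIV :: 'u set)"
  let ?G = "{y \<in> gens. H \<subseteq> y}"
  obtain M where M: "M \<in> gens" "H \<subseteq> M" using iso_extend[OF H(1)] by blast
  note isoM = gens_iso[OF M(1)] and sH = isoD(1)[OF H(1)]
  note sM = isoD(1)[OF isoM]
  have q2: "?q \<ge> 2" by (rule card_field_ge_2)
  have N2: "2 * D \<le> ?N" using dim_iso_le[OF isoM] dim_gens[OF M(1)] by simp
  have hyp: "hyperplane H y" if "y \<in> ?G" for y
    using that H sH dim_gens by (simp add: hyperplane_def)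
  obtain m where m: "m \<in> M" "m \<notin> H"
    using hyp[of M] M by (metis (no_types, lifting) mem_Collect_eq hyperplane_def
        add_eq_self_zero one_neq_zero subset_antisym subsetI)
  have Mm: "span (insert m H) = M"
    using hyp[of M] M m sM by (intro hyperplane_span_insert) auto
  let ?P = "{v \<in> perp H. sing v} - H"
  let ?Z = "perp H - perp M" and ?R = "{v \<in> perp H - perp M. sing v}"
  have fibre: "{v \<in> ?P. span (insert v H) = y} = y - H" if y: "y \<in> ?G" for y
  proof (rule equalityI; rule subsetI)
    fix v assume "v \<in> {v \<in> ?P. span (insert v H) = y}"
    then show "v \<in> y - H" using span_base[of v "insert v H"] by auto
  next
    fix v assume v: "v \<in> y - H"
    have "y \<subseteq> perp H"
      using isoD(3)[OF gens_iso] perp_antimono[of H y] y by blast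
    then show "v \<in> {v \<in> ?P. span (insert v H) = y}"
      using v y isoD(2)[OF gens_iso] hyperplane_span_insert[OF hyp[OF y] gens_subspace] by auto
  qed
  have qD: "?q ^ D = ?q * ?q ^ (D - 1)"
    using D_pos by (simp flip: power_Suc)
  have cfib: "card (y - H) = ?q ^ (D - 1) * (?q - 1)" if y: "y \<in> ?G" for y
  proof -
    have "card y = ?q ^ D" "card H = ?q ^ (D - 1)"
      using card_subspace[OF gens_subspace] dim_gens y card_subspace[OF sH] H by auto
    then show ?thesis using y qD
      by (simp add: card_Diff_subset diff_mult_distrib diff_mult_distrib2 mult.commute)
  qed
  have "card ?P = (\<Sum>y\<in>?G. card {v \<in> ?P. span (insert v H) = y})"
  proof (rule card_eq_sum_fibers)
    fix v assume v: "v \<in> ?P"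
    then have "span (insert v H) \<in> gens"
      using H by (intro span_insert_gens) auto
    then show "span (insert v H) \<in> ?G"
      using span_superset[of "insert v H"] by blast
  qed simp_all
  also have "\<dots> = (\<Sum>y\<in>?G. ?q ^ (D - 1) * (?q - 1))"
    using fibre cfib by (intro sum.cong) auto
  finally have 1: "card ?P = card ?G * (?q ^ (D - 1) * (?q - 1))"
    by simp
  have mperp: "m \<in> perp M" using m isoD(3)[OF isoM] by auto
  have pMH: "perp M \<subseteq> perp H" by (rule perp_antimono[OF M(2)])
  have HpM: "H \<subseteq> perp M" using M isoD(3)[OF isoM] by auto
  \<comment> \<open>A vector of \<open>?P\<close> inside \<open>perp M\<close> belongs to
    \<open>M\<close> by maximality; \<open>?R\<close> collects the others.\<close>
  have "?P = (M - H) \<union> ?R"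
    using gens_absorb[OF M(1)] isoD(2)[OF isoM] isoD(3)[OF isoM] pMH HpM by auto
  moreover have "(M - H) \<inter> ?R = {}"
    using isoD(3)[OF isoM] by auto
  ultimately have 2: "card ?P = ?q ^ (D - 1) * (?q - 1) + card ?R"
    using cfib[of M] M by (simp add: card_Un_disjoint)
  have Bm: "B v m \<noteq> 0" if v: "v \<in> ?Z" for v
  proof
    assume "B v m = 0"
    then have "v \<in> perp (insert m H)" using v by (auto simp: perp_def)
    then have "v \<in> perp M" using perp_span[of "insert m H"] Mm by simp
    then show False using v by simp
  qed
  have shift: "v + a *s m \<in> ?Z \<longleftrightarrow> v \<in> ?Z" for v a
  proof -
    have "a *s m \<in> perp M" using mperp subspace_perp by (simp add: subspace_scale)
    then have "v + a *s m \<in> W \<longleftrightarrow> v \<in> W" if "subspace W" "perp M \<subseteq> W" for W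
      using that by (metis add_diff_cancel_right' subspace_add subspace_diff subsetD)
    then show ?thesis using pMH subspace_perp by simp
  qed
  \<comment> \<open>Pairs of a vector of \<open>?Z\<close> and a singular vector on its line in
    direction \<open>m\<close> are counted twice: by the first vector, and by the singular vector
    \<open>w\<close>, which occurs exactly \<open>?q\<close> times.\<close>
  have "card (SIGMA v:?Z. {a. sing (v + a *s m)}) = (\<Sum>v\<in>?Z. s)"
    using sing_count[OF isoD(2)[OF isoM m(1)]] Bm by (subst card_SigmaI) auto
  also have "(SIGMA v:?Z. {a. sing (v + a *s m)}) = (\<lambda>(w, a). (w - a *s m, a)) ` (?R \<times> UNIV)"
  proof (rule equalityI; rule subsetI)
    fix c assume "c \<in> (SIGMA v:?Z. {a. sing (v + a *s m)})"
    then obtain v a where "c = (v, a)" "v \<in> ?Z" "sing (v + a *s m)" by auto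
    then show "c \<in> (\<lambda>(w, a). (w - a *s m, a)) ` (?R \<times> UNIV)"
      using shift[of v a] by (intro image_eqI[of _ _ "(v + a *s m, a)"]) auto
  next
    fix c assume "c \<in> (\<lambda>(w, a). (w - a *s m, a)) ` (?R \<times> UNIV)"
    then obtain w a where c: "c = (w - a *s m, a)" "w \<in> ?R" by auto
    then show "c \<in> (SIGMA v:?Z. {a. sing (v + a *s m)})"
      using shift[of "w - a *s m" a] by auto
  qed
  also have "card \<dots> = card ?R * ?q"
    by (subst card_image) (auto simp: inj_on_def card_cartesian_product)
  finally have "card ?R * ?q = s * card ?Z" by simp
  also have "card ?Z = ?q ^ (?N - D) * (?q - 1)"
  proof -
    have "dim (perp H) = Suc (?N - D)" "dim (perp M) = ?N - D"
      using dim_perp[OF H(1)] dim_perp[OF isoM] H N2 dim_gens[OF M(1)] by linarith+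
    then show ?thesis
      using pMH card_subspace[OF subspace_perp]
      by (simp add: card_Diff_subset diff_mult_distrib diff_mult_distrib2 mult.commute)
  qed
  also have "?q ^ (?N - D) = ?q ^ (?N - 2 * D) * (?q * ?q ^ (D - 1))"
  proof -
    have "?N - D = (?N - 2 * D) + D" using N2 by simp
    then show ?thesis by (simp only: power_add qD)
  qed
  finally have "card ?R * ?q = t * (?q ^ (D - 1) * (?q - 1)) * ?q"
    by (simp add: t_def mult_ac)
  then have "card ?R = t * (?q ^ (D - 1) * (?q - 1))"
    using q2 by simp
  then have "card ?G * (?q ^ (D - 1) * (?q - 1)) = (t + 1) * (?q ^ (D - 1) * (?q - 1))"
    using 1 2 by simp
  then show ?thesis
    by (rule mult_right_cancel[THEN iffD1, rotated]) (use q2 in simp)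
qed

section \<open>Adjacency and neighbours through a subspace\<close>

definition adj :: "'u set \<Rightarrow> 'u set \<Rightarrow> bool" where
  "adj y z \<longleftrightarrow> y \<in> gens \<and> z \<in> gens \<and> dim (y \<inter> z) + 1 = D"

lemma adj_sym: "adj y z \<Longrightarrow> adj z y"
  by (simp add: adj_def Int_commute)

lemma adjD:
  assumes "adj y z"
  shows "y \<in> gens" "z \<in> gens" "y \<noteq> z" "hyperplane (y \<inter> z) y" "hyperplane (y \<inter> z) z"
    "iso (y \<inter> z)" "dim (y \<inter> z) + 1 = D"
proof -
  show *: "y \<in> gens" "z \<in> gens" "dim (y \<inter> z) + 1 = D"
    using assms by (simp_all add: adj_def)
  show "y \<noteq> z"
  proof
    assume "y = z"
    then show False using *(3) dim_gens[OF *(2)] by simp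
  qed
  have "subspace (y \<inter> z)" by (simp add: * gens_subspace subspace_inter)
  then show "hyperplane (y \<inter> z) y" "hyperplane (y \<inter> z) z" "iso (y \<inter> z)"
    using * dim_gens iso_subspace[OF gens_iso] by (auto simp: hyperplane_def)
qed

lemma gens_Int_eq:
  assumes H: "subspace H" "dim H + 1 = D" and y: "y \<in> gens" "H \<subseteq> y"
    and z: "z \<in> gens" "H \<subseteq> z" and "y \<noteq> z"
  shows "y \<inter> z = H" "adj y z"
proof -
  have sub: "subspace (y \<inter> z)" using y z by (simp add: gens_subspace subspace_inter)
  have "\<not> D \<le> dim (y \<inter> z)"
  proof
    assume D: "D \<le> dim (y \<inter> z)"
    have "y \<inter> z = y"
      using D y sub by (intro subspace_dim_equal) (auto simp: gens_subspace dim_gens)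
    moreover have "y \<inter> z = z"
      using D z sub by (intro subspace_dim_equal) (auto simp: gens_subspace dim_gens)
    ultimately show False using \<open>y \<noteq> z\<close> by blast
  qed
  then have "H = y \<inter> z"
    using H y z sub by (intro subspace_dim_equal) auto
  then show "y \<inter> z = H" "adj y z"
    using H y z by (auto simp: adj_def)
qed

text \<open>Sort the neighbours \<open>y\<close> of \<open>z\<close> by the hyperplane
  \<open>y \<inter> z\<close> of \<open>z\<close>: there are \<open>gauss (D - dim S)\<close>
  hyperplanes over \<open>S\<close>, each contained in \<open>t\<close> generators besides
  \<open>z\<close>.\<close>

lemma card_adj_containing:
  assumes z: "z \<in> gens" and S: "subspace S" "S \<subseteq> z"
  shows "card {y. adj y z \<and> S \<subseteq> y} = t * gauss (D - dim S)"
proof -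
  let ?\<H> = "{H. hyperplane H z \<and> S \<subseteq> H}" and ?Y = "{y. adj y z \<and> S \<subseteq> y}"
  have fibre: "card {y \<in> ?Y. y \<inter> z = H} = t" if H: "H \<in> ?\<H>" for H
  proof -
    have Hh: "subspace H" "H \<subseteq> z" "dim H + 1 = D"
      using H dim_gens[OF z] by (auto simp: hyperplane_def)
    have "{y \<in> ?Y. y \<inter> z = H} = {y \<in> gens. H \<subseteq> y} - {z}"
    proof (rule equalityI; rule subsetI)
      fix y assume "y \<in> {y \<in> ?Y. y \<inter> z = H}"
      then show "y \<in> {y \<in> gens. H \<subseteq> y} - {z}" using adjD(1,3) by blast
    next
      fix y assume y: "y \<in> {y \<in> gens. H \<subseteq> y} - {z}"
      then have "y \<inter> z = H" "adj y z" using gens_Int_eq[OF Hh(1,3) _ _ z Hh(2), of y] by auto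
      then show "y \<in> {y \<in> ?Y. y \<inter> z = H}" using y H by auto
    qed
    moreover have "card \<dots> = t"
      using card_gens_containing[OF iso_subspace[OF gens_iso[OF z] Hh(1,2)] Hh(3)] z Hh(2)
      by simp
    ultimately show ?thesis by simp
  qed
  have "card ?Y = (\<Sum>H\<in>?\<H>. card {y \<in> ?Y. y \<inter> z = H})"
    using S adjD(5) by (intro card_eq_sum_fibers) auto
  also have "\<dots> = card ?\<H> * t"
    using fibre by simp
  finally show ?thesis
    using card_hyperplanes_containing[OF gens_iso[OF z] S] dim_gens[OF z] by simp
qed

lemma hyperplane_Int_if_adj:
  assumes "adj y z" "subspace S" "S \<subseteq> y" "\<not> S \<subseteq> z"
  shows "hyperplane (z \<inter> S) S"
proof -
  have "hyperplane (S \<inter> (y \<inter> z)) S"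
    using assms gens_subspace[OF adjD(1)[OF assms(1)]]
    by (intro hyperplane_Int[OF adjD(4)[OF assms(1)]]) auto
  moreover have "S \<inter> (y \<inter> z) = z \<inter> S" using assms by auto
  ultimately show ?thesis by simp
qed

text \<open>For \<open>p\<close> in \<open>S\<close> outside \<open>z\<close>, a neighbour
  containing \<open>p\<close> must meet \<open>z\<close> in \<open>z \<inter> perp {p}\<close>,
  which leaves only the span of that hyperplane and \<open>p\<close>. It contains \<open>S\<close>,
  which is spanned by \<open>p\<close> and \<open>z \<inter> S\<close>.\<close>

lemma unique_adj_containing:
  assumes z: "z \<in> gens" and S: "iso S" and zS: "hyperplane (z \<inter> S) S"
  obtains y where "{y. adj y z \<and> S \<subseteq> y} = {y}"
proof -
  note sz = gens_subspace[OF z]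
  have "z \<inter> S \<noteq> S" using hyperplaneD(3)[OF zS] by auto
  then obtain p where p: "p \<in> S" "p \<notin> z" by auto
  have sp: "sing p" using isoD(2)[OF S p(1)] .
  have "p \<notin> perp z" using gens_absorb[OF z sp] p by auto
  then obtain w where w: "w \<in> z" "B p w \<noteq> 0" by (auto simp: perp_def)
  then have "B w p \<noteq> 0" using B_refl by blast
  let ?K = "z \<inter> perp {p}"
  have K: "hyperplane ?K z"
    by (rule hyperplane_perp_singleton[OF sz w(1)]) fact
  have dK: "dim ?K + 1 = D" and isoK: "iso ?K" and sK: "subspace ?K"
    using hyperplaneD[OF K] dim_gens[OF z] iso_subspace[OF gens_iso[OF z]] by auto
  define y where "y = span (insert p ?K)"
  have "p \<in> perp ?K" using subset_perp_commute[of "{p}" ?K] by auto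
  then have y: "y \<in> gens"
    unfolding y_def using isoK dK sp p by (intro span_insert_gens) auto
  have Ky: "?K \<subseteq> y" "p \<in> y"
    unfolding y_def using span_superset[of "insert p ?K"] by auto
  have "y \<noteq> z" using Ky p by auto
  then have adj: "adj y z"
    using gens_Int_eq(2)[OF sK dK y Ky(1) z] by auto
  have "S \<subseteq> perp {p}"
    using isoD(3)[OF S] perp_antimono[of "{p}" S] p by auto
  then have "S \<subseteq> y"
    using hyperplane_span_insert[OF zS isoD(1)[OF S] p(1)] p Ky
      span_insert_least[OF gens_subspace[OF y], of p "z \<inter> S"] by auto
  moreover have "y' = y" if y': "adj y' z" "S \<subseteq> y'" for y'
  proof -
    note a = adjD[OF y'(1)]
    have "p \<in> y'" using p y' by auto
    then have "y' \<subseteq> perp {p}"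
      using isoD(3)[OF gens_iso[OF a(1)]] perp_antimono[of "{p}" y'] by auto
    then have "y' \<inter> z = ?K"
      using a(7) dK sK isoD(1)[OF a(6)] by (intro subspace_dim_equal) auto
    then have "y \<subseteq> y'"
      unfolding y_def using \<open>p \<in> y'\<close> gens_subspace[OF a(1)] by (intro span_insert_least) auto
    then show ?thesis using gens_eq[OF y a(1)] by simp
  qed
  ultimately have "{y. adj y z \<and> S \<subseteq> y} = {y}" using adj by blast
  then show ?thesis by (rule that)
qed

section \<open>Intersection with a fixed generator\<close>

text \<open>
  The generators through \<open>H\<close> form a line of the near polygon of generators, and \<open>y\<close> is the
  point on that line nearest to \<open>x\<close>.
\<close>

lemma nearest_generator:
  assumes x: "x \<in> gens" and H: "iso H" "dim H + 1 = D"
  obtains y where "y \<in> gens" "H \<subseteq> y" "hyperplane (x \<inter> H) (x \<inter> y)"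
    "\<And>z. z \<in> gens \<Longrightarrow> H \<subseteq> z \<Longrightarrow> z \<noteq> y \<Longrightarrow> x \<inter> z = x \<inter> H"
proof -
  note sx = gens_subspace[OF x] and sH = isoD(1)[OF H(1)]
  \<comment> \<open>As \<open>dim H < dim x\<close>, this bound yields a vector \<open>v\<close> of
    \<open>x\<close> orthogonal to \<open>H\<close> and outside \<open>H\<close>; together with
    \<open>H\<close> it spans the nearest generator.\<close>
  have "dim x + dim (x \<inter> H) \<le> dim (x \<inter> perp H) + dim H"
    using isoD(3)[OF gens_iso[OF x]] perp_antimono[of "x \<inter> H" x]
    by (intro dim_Int_perp sx sH) auto
  then have "dim (x \<inter> H) < dim (x \<inter> perp H)"
    using H dim_gens[OF x] by linarith
  then have "\<not> x \<inter> perp H \<subseteq> x \<inter> H"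
    using dim_subset not_le by blast
  then obtain v where v: "v \<in> x" "v \<in> perp H" "v \<notin> H" by auto
  have sv: "sing v" using isoD(2)[OF gens_iso[OF x] v(1)] .
  define y where "y = span (insert v H)"
  have y: "y \<in> gens" unfolding y_def by (rule span_insert_gens) (use H sv v in auto)
  have Hy: "H \<subseteq> y" "v \<in> y"
    unfolding y_def using span_superset[of "insert v H"] by auto
  have "hyperplane ((x \<inter> y) \<inter> H) (x \<inter> y)"
    using H sH Hy v gens_subspace[OF y] sx dim_gens[OF y]
    by (intro hyperplane_Int[of _ y]) (auto simp: hyperplane_def subspace_inter)
  moreover have "(x \<inter> y) \<inter> H = x \<inter> H" using Hy by auto
  ultimately have hyp: "hyperplane (x \<inter> H) (x \<inter> y)" by simp
  have "x \<inter> z = x \<inter> H" if z: "z \<in> gens" "H \<subseteq> z" "z \<noteq> y" for z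
  proof (rule ccontr)
    assume "x \<inter> z \<noteq> x \<inter> H"
    then obtain w where w: "w \<in> x" "w \<in> z" "w \<notin> H" using z by auto
    have "w \<in> perp H"
      using w isoD(3)[OF gens_iso[OF z(1)]] perp_antimono[OF z(2)] by auto
    moreover have "B w v = 0"
      using w v isoD(3)[OF gens_iso[OF x]] by (auto simp: perp_def)
    ultimately have "w \<in> perp (insert v H)" by (simp add: perp_def)
    then have "w \<in> perp y" by (simp add: y_def perp_span)
    then have "w \<in> y"
      using gens_absorb[OF y isoD(2)[OF gens_iso[OF x] w(1)]] by simp
    moreover have "y \<inter> z = H"
      using gens_Int_eq(1)[OF sH H(2) y Hy(1) z(1,2)] z(3) by auto
    ultimately show False using w by auto
  qed
  then show ?thesis using that y Hy hyp by blast
qed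

text \<open>Among the generators through \<open>y \<inter> z\<close>, all except the nearest one
  meet \<open>x\<close> in \<open>x \<inter> (y \<inter> z)\<close>, and at most one of
  \<open>y\<close> and \<open>z\<close> is the nearest.\<close>

lemma adj_Int_cases:
  assumes x: "x \<in> gens" and a: "adj y z"
  shows "x \<inter> y = x \<inter> z \<or> hyperplane (x \<inter> y) (x \<inter> z) \<or> hyperplane (x \<inter> z) (x \<inter> y)"
proof -
  note a' = adjD[OF a]
  obtain w where w: "hyperplane (x \<inter> (y \<inter> z)) (x \<inter> w)"
    "\<And>z'. z' \<in> gens \<Longrightarrow> y \<inter> z \<subseteq> z' \<Longrightarrow> z' \<noteq> w \<Longrightarrow> x \<inter> z' = x \<inter> (y \<inter> z)"
    using nearest_generator[OF x a'(6,7)] by metis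
  consider "y = w" | "z = w" | "y \<noteq> w" "z \<noteq> w" by blast
  then show ?thesis
    using w(1) w(2)[of y] w(2)[of z] a'(1,2,3) by cases auto
qed

text \<open>Of the neighbours of \<open>z\<close> containing \<open>x \<inter> z\<close>, exactly
  one over each hyperplane of \<open>z\<close> through \<open>x \<inter> z\<close> meets
  \<open>x\<close> in more, namely the nearest generator. The additive form expresses the factor
  \<open>t - 1\<close> without subtraction.\<close>

lemma card_adj_same_Int:
  assumes x: "x \<in> gens" and z: "z \<in> gens"
  shows "card {y. adj y z \<and> x \<inter> y = x \<inter> z} + gauss (D - dim (x \<inter> z)) = t * gauss (D - dim (x \<inter> z))"
proof -
  let ?\<eta> = "x \<inter> z"
  let ?\<H> = "{H. hyperplane H z \<and> ?\<eta> \<subseteq> H}"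
  let ?C = "{y. adj y z \<and> x \<inter> y = ?\<eta>}"
  let ?Bad = "{y. adj y z \<and> ?\<eta> \<subseteq> y \<and> x \<inter> y \<noteq> ?\<eta>}"
  have s\<eta>: "subspace ?\<eta>" using x z by (simp add: gens_subspace subspace_inter)
  have near: "\<exists>y. y \<in> gens \<and> H \<subseteq> y \<and> x \<inter> y \<noteq> ?\<eta> \<and> (\<forall>z'\<in>gens. H \<subseteq> z' \<longrightarrow> z' \<noteq> y \<longrightarrow> x \<inter> z' = ?\<eta>)"
    if H: "H \<in> ?\<H>" for H
  proof -
    have Hh: "iso H" "dim H + 1 = D" "x \<inter> H = ?\<eta>"
      using H dim_gens[OF z] iso_subspace[OF gens_iso[OF z]] by (auto simp: hyperplane_def)
    obtain y where y: "y \<in> gens" "H \<subseteq> y" "hyperplane (x \<inter> H) (x \<inter> y)"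
      "\<And>z. z \<in> gens \<Longrightarrow> H \<subseteq> z \<Longrightarrow> z \<noteq> y \<Longrightarrow> x \<inter> z = x \<inter> H"
      using nearest_generator[OF x Hh(1,2)] by blast
    moreover have "x \<inter> y \<noteq> ?\<eta>" using hyperplaneD(3)[OF y(3)] Hh by auto
    ultimately show ?thesis unfolding Hh(3) by blast
  qed
  have "bij_betw (\<lambda>y. y \<inter> z) ?Bad ?\<H>"
    unfolding bij_betw_def
  proof
    show "inj_on (\<lambda>y. y \<inter> z) ?Bad"
    proof (rule inj_onI)
      fix y y' assume y: "y \<in> ?Bad" and y': "y' \<in> ?Bad" and eq: "y \<inter> z = y' \<inter> z"
      have "y \<inter> z \<in> ?\<H>" using y adjD(5)[of y z] by auto
      from near[OF this] obtain w where
        w: "\<forall>z'\<in>gens. y \<inter> z \<subseteq> z' \<longrightarrow> z' \<noteq> w \<longrightarrow> x \<inter> z' = ?\<eta>" by blast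
      have "y \<in> gens" "y' \<in> gens" using y y' adjD(1) by auto
      moreover have "y \<inter> z \<subseteq> y" "y \<inter> z \<subseteq> y'" using eq by auto
      ultimately have "y = w" "y' = w" using w y y' by blast+
      then show "y = y'" by simp
    qed
    show "(\<lambda>y. y \<inter> z) ` ?Bad = ?\<H>"
    proof
      show "(\<lambda>y. y \<inter> z) ` ?Bad \<subseteq> ?\<H>" using adjD(5) by auto
      show "?\<H> \<subseteq> (\<lambda>y. y \<inter> z) ` ?Bad"
      proof
        fix H assume H: "H \<in> ?\<H>"
        from near[OF H] obtain w where w: "w \<in> gens" "H \<subseteq> w" "x \<inter> w \<noteq> ?\<eta>" by blast
        then have "w \<noteq> z" by auto
        moreover have "subspace H" "dim H + 1 = D" "H \<subseteq> z"
          using H dim_gens[OF z] by (auto simp: hyperplane_def)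
        ultimately have "w \<inter> z = H" "adj w z"
          using gens_Int_eq[OF _ _ w(1,2) z] by auto
        then show "H \<in> (\<lambda>y. y \<inter> z) ` ?Bad" using w H by (auto intro!: image_eqI[of _ _ w])
      qed
    qed
  qed
  then have "card ?Bad = gauss (D - dim ?\<eta>)"
    using card_hyperplanes_containing[OF gens_iso[OF z] s\<eta>] dim_gens[OF z]
    by (simp add: bij_betw_same_card)
  moreover have "{y. adj y z \<and> ?\<eta> \<subseteq> y} = ?C \<union> ?Bad" "?C \<inter> ?Bad = {}" by auto
  ultimately show ?thesis
    using card_adj_containing[OF z s\<eta>] by (simp add: card_Un_disjoint)
qed

text \<open>The neighbours wanted are those containing \<open>\<eta>\<close> but not
  \<open>x \<inter> z\<close>; the two counts differ by \<open>t\<close> times the top term of a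
  Gaussian number.\<close>

lemma card_adj_smaller_Int:
  assumes x: "x \<in> gens" and z: "z \<in> gens" and \<eta>: "hyperplane \<eta> (x \<inter> z)"
  shows "card {y. adj y z \<and> x \<inter> y = \<eta>} = t * CARD('f) ^ (D - dim \<eta> - 1)"
proof -
  let ?\<zeta> = "x \<inter> z"
  note h = hyperplaneD[OF \<eta>]
  have s\<zeta>: "subspace ?\<zeta>" using x z by (simp add: gens_subspace subspace_inter)
  have "{y. adj y z \<and> x \<inter> y = \<eta>} = {y. adj y z \<and> \<eta> \<subseteq> y} - {y. adj y z \<and> ?\<zeta> \<subseteq> y}"
  proof (rule equalityI; rule subsetI)
    fix y assume "y \<in> {y. adj y z \<and> x \<inter> y = \<eta>}"
    moreover have "\<not> ?\<zeta> \<subseteq> \<eta>" using h dim_subset[of ?\<zeta> \<eta>] by auto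
    ultimately show "y \<in> {y. adj y z \<and> \<eta> \<subseteq> y} - {y. adj y z \<and> ?\<zeta> \<subseteq> y}" by auto
  next
    fix y assume y: "y \<in> {y. adj y z \<and> \<eta> \<subseteq> y} - {y. adj y z \<and> ?\<zeta> \<subseteq> y}"
    then have "hyperplane (x \<inter> y) ?\<zeta>"
      using adj_Int_cases[OF x, of y z] by (auto simp: hyperplane_def)
    then have "\<eta> = x \<inter> y"
      using h y by (intro subspace_dim_equal) (auto simp: hyperplane_def)
    then show "y \<in> {y. adj y z \<and> x \<inter> y = \<eta>}" using y by auto
  qed
  moreover have "{y. adj y z \<and> ?\<zeta> \<subseteq> y} \<subseteq> {y. adj y z \<and> \<eta> \<subseteq> y}" using h by auto
  ultimately have "card {y. adj y z \<and> x \<inter> y = \<eta>} = t * gauss (D - dim \<eta>) - t * gauss (D - dim ?\<zeta>)"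
    using card_adj_containing[OF z s\<zeta>] card_adj_containing[OF z h(1)] h(2)
    by (simp add: card_Diff_subset)
  moreover have "dim ?\<zeta> \<le> D" using dim_subset[of ?\<zeta> z] dim_gens[OF z] by simp
  then have "D - dim \<eta> = Suc (D - dim ?\<zeta>)" using h by linarith
  ultimately show ?thesis by (simp add: gauss_simps distrib_left)
qed

text \<open>Here \<open>z \<inter> \<eta> = x \<inter> z\<close> is a hyperplane of
  \<open>\<eta>\<close>, so exactly one neighbour contains \<open>\<eta>\<close>; it meets
  \<open>x\<close> in no more, because adjacency changes the dimension by at most one.\<close>

lemma card_adj_larger_Int:
  assumes x: "x \<in> gens" and z: "z \<in> gens" and \<eta>: "hyperplane (x \<inter> z) \<eta>" "subspace \<eta>" "\<eta> \<subseteq> x"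
  shows "card {y. adj y z \<and> x \<inter> y = \<eta>} = 1"
proof -
  let ?\<zeta> = "x \<inter> z"
  note h = hyperplaneD[OF \<eta>(1)]
  have "{y. adj y z \<and> x \<inter> y = \<eta>} = {y. adj y z \<and> \<eta> \<subseteq> y}"
  proof (rule equalityI; rule subsetI)
    fix y assume y: "y \<in> {y. adj y z \<and> \<eta> \<subseteq> y}"
    then have sub: "\<eta> \<subseteq> x \<inter> y" using \<eta> by auto
    then have "dim \<eta> \<le> dim (x \<inter> y)" by (rule dim_subset)
    then have "hyperplane ?\<zeta> (x \<inter> y)"
      using adj_Int_cases[OF x, of y z] y h by (auto simp: hyperplane_def)
    then have "\<eta> = x \<inter> y"
      using h \<eta> sub y x gens_subspace adjD(1)[of y z]
      by (intro subspace_dim_equal) (auto simp: hyperplane_def subspace_inter)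
    then show "y \<in> {y. adj y z \<and> x \<inter> y = \<eta>}" using y by auto
  qed auto
  moreover have "z \<inter> \<eta> = ?\<zeta>" using \<eta> h by auto
  then obtain y where "{y. adj y z \<and> \<eta> \<subseteq> y} = {y}"
    using unique_adj_containing[OF z iso_subspace[OF gens_iso[OF x] \<eta>(2,3)]] \<eta> by auto
  ultimately show ?thesis by simp
qed

end

section \<open>Eigenvectors of the adjacency matrix\<close>

lemma mat_vec_diff_sum:
  "mat_vec X M (\<lambda>y. v y - (\<Sum>j\<in>J. c j * w j y)) =
    (\<lambda>y. mat_vec X M v y - (\<Sum>j\<in>J. c j * mat_vec X M (w j) y))"
proof
  fix y
  have "(\<Sum>z\<in>X. M y z * (\<Sum>j\<in>J. c j * w j z)) = (\<Sum>j\<in>J. c j * (\<Sum>z\<in>X. M y z * w j z))"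
    by (simp add: sum_distrib_left mult_ac) (rule sum.swap)
  then show "mat_vec X M (\<lambda>y. v y - (\<Sum>j\<in>J. c j * w j y)) y =
      mat_vec X M v y - (\<Sum>j\<in>J. c j * mat_vec X M (w j) y)"
    by (simp add: mat_vec_def right_diff_distrib sum_subtractf)
qed

lemma mat_vec_sum:
  "mat_vec X M (\<lambda>y. \<Sum>j\<in>J. w j y) = (\<lambda>y. \<Sum>j\<in>J. mat_vec X M (w j) y)"
  by (rule ext) (simp add: mat_vec_def sum_distrib_left, rule sum.swap)

lemma mat_vec_scale:
  "mat_vec X M (\<lambda>y. c * v y) = (\<lambda>y. c * mat_vec X M v y)"
  by (simp add: fun_eq_iff mat_vec_def sum_distrib_left mult_ac)

lemma mat_vec_diff:
  "mat_vec X M (\<lambda>y. v y - w y) = (\<lambda>y. mat_vec X M v y - mat_vec X M w y)"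
  by (simp add: fun_eq_iff mat_vec_def right_diff_distrib sum_subtractf)

lemma eigenspace_scale:
  assumes "v \<in> eigenspace X M c"
  shows "(\<lambda>y. a * v y) \<in> eigenspace X M c"
  using assms by (simp add: eigenspace_def vecs_def mat_vec_scale mult_ac)

context polar_rank
begin

lemma card_adj_containing_cases:
  assumes S: "iso S" and z: "z \<in> gens"
  shows "card {y. adj y z \<and> S \<subseteq> y} =
    (if S \<subseteq> z then t * gauss (D - dim S) else if hyperplane (z \<inter> S) S then 1 else 0)"
proof -
  consider "S \<subseteq> z" | "\<not> S \<subseteq> z" "hyperplane (z \<inter> S) S" | "\<not> S \<subseteq> z" "\<not> hyperplane (z \<inter> S) S"
    by blast
  then show ?thesis
  proof cases
    case 1
    then show ?thesis using card_adj_containing[OF z isoD(1)[OF S]] by simp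
  next
    case 2
    then obtain y where "{y. adj y z \<and> S \<subseteq> y} = {y}"
      using unique_adj_containing[OF z S] by blast
    then show ?thesis using 2 by simp
  next
    case 3
    then have "{y. adj y z \<and> S \<subseteq> y} = {}"
      using hyperplane_Int_if_adj[OF _ isoD(1)[OF S]] by blast
    then show ?thesis using 3 by simp
  qed
qed

text \<open>Every such \<open>T\<close> lies in \<open>z \<inter> S\<close>, a proper subspace of
  \<open>S\<close>, hence equals it. This lets \<open>nsum_A\<close> trade an indicator for a sum
  over hyperplanes.\<close>

lemma card_hyperplanes_inside:
  assumes S: "subspace S" and z: "subspace z" "\<not> S \<subseteq> z"
  shows "card {T. hyperplane T S \<and> T \<subseteq> z} = (if hyperplane (z \<inter> S) S then 1 else 0)"
proof -
  have *: "T = z \<inter> S" if T: "hyperplane T S" "T \<subseteq> z" for T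
  proof (rule subspace_dim_equal)
    show "subspace (z \<inter> S)" by (simp add: S z subspace_inter)
    then have "\<not> dim S \<le> dim (z \<inter> S)"
      using subspace_dim_equal[of "z \<inter> S" S] S z by auto
    then show "dim (z \<inter> S) \<le> dim T" using T by (simp add: hyperplane_def)
  qed (use T in \<open>auto simp: hyperplane_def\<close>)
  show ?thesis
  proof (cases "hyperplane (z \<inter> S) S")
    case True
    then have "{T. hyperplane T S \<and> T \<subseteq> z} = {z \<inter> S}" using * by blast
    then show ?thesis using True by simp
  next
    case False
    then have "{T. hyperplane T S \<and> T \<subseteq> z} = {}" using * by blast
    then show ?thesis using False by simp
  qed
qed

lemma card_hyperplanes:
  assumes S: "iso S"
  shows "card {T. hyperplane T S} = gauss (dim S)"
proof -
  have "{T. hyperplane T S} = {T. hyperplane T S \<and> {0} \<subseteq> T}"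
    by (auto simp: hyperplane_def subspace_0)
  then show ?thesis
    using card_hyperplanes_containing[OF S subspace_single_0] subspace_0[OF isoD(1)[OF S]]
    by simp
qed

section \<open>The adjacency matrix and sums over generators\<close>

definition A :: "'u set \<Rightarrow> 'u set \<Rightarrow> complex" where
  "A y z = (if adj y z then 1 else 0)"

text \<open>The entry at \<open>S\<close> of \<open>N\<^sub>k v\<close>, for
  \<open>k = dim S\<close>.\<close>

definition nsum :: "('u set \<Rightarrow> complex) \<Rightarrow> 'u set \<Rightarrow> complex" where
  "nsum v S = (\<Sum>y | y \<in> gens \<and> S \<subseteq> y. v y)"

text \<open>With \<open>t\<close> equal to q^(e + 1) this is \<open>dual_polar_theta\<close> in
  Gaussian numbers; \<open>theta_1\<close> proves the case \<open>k = 1\<close>.\<close>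

definition \<theta> :: "nat \<Rightarrow> complex" where
  "\<theta> k = of_nat (t * gauss (D - k)) - of_nat (gauss k)"

text \<open>The coefficient of \<open>v z\<close> on the left is the number of neighbours of
  \<open>z\<close> through \<open>S\<close>. It is \<open>t * gauss (D - dim S)\<close> if
  \<open>S \<subseteq> z\<close>; otherwise it is the number, 0 or 1, of hyperplanes of
  \<open>S\<close> inside \<open>z\<close>, which the differences \<open>nsum v T - nsum v S\<close>
  collect.\<close>

lemma nsum_A:
  assumes S: "iso S"
  shows "nsum (mat_vec gens A v) S =
    of_nat (t * gauss (D - dim S)) * nsum v S + (\<Sum>T | hyperplane T S. nsum v T - nsum v S)"
proof -
  let ?c = "of_nat (t * gauss (D - dim S)) :: complex"
  have l: "nsum (mat_vec gens A v) S = (\<Sum>z\<in>gens. of_nat (card {y. adj y z \<and> S \<subseteq> y}) * v z)"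
  proof -
    have "(\<Sum>y | y \<in> gens \<and> S \<subseteq> y. A y z) = of_nat (card {y. adj y z \<and> S \<subseteq> y})" for z
    proof -
      have "(\<Sum>y | y \<in> gens \<and> S \<subseteq> y. A y z) = (\<Sum>y | y \<in> gens \<and> S \<subseteq> y \<and> adj y z. 1)"
        unfolding A_def by (rule sum.mono_neutral_cong_right) auto
      also have "{y. y \<in> gens \<and> S \<subseteq> y \<and> adj y z} = {y. adj y z \<and> S \<subseteq> y}"
        using adjD(1) by blast
      finally show ?thesis by simp
    qed
    then show ?thesis
      unfolding nsum_def mat_vec_def by (subst sum.swap) (simp flip: sum_distrib_right)
  qed
  have "(\<Sum>T | hyperplane T S. nsum v T - nsum v S)
      = (\<Sum>T | hyperplane T S. \<Sum>z\<in>gens. if T \<subseteq> z \<and> \<not> S \<subseteq> z then v z else 0)"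
  proof (rule sum.cong)
    fix T assume "T \<in> {T. hyperplane T S}"
    then have "T \<subseteq> S" by (simp add: hyperplane_def)
    then have "nsum v T = nsum v S + (\<Sum>z | z \<in> gens \<and> T \<subseteq> z \<and> \<not> S \<subseteq> z. v z)"
      unfolding nsum_def by (subst sum.union_disjoint[symmetric]) (auto intro!: sum.cong)
    then show "nsum v T - nsum v S = (\<Sum>z\<in>gens. if T \<subseteq> z \<and> \<not> S \<subseteq> z then v z else 0)"
      by (simp add: sum.If_cases Int_def)
  qed simp
  also have "\<dots> = (\<Sum>z\<in>gens. \<Sum>T | hyperplane T S. if T \<subseteq> z \<and> \<not> S \<subseteq> z then v z else 0)"
    by (rule sum.swap)
  also have "\<dots> = (\<Sum>z\<in>gens. if \<not> S \<subseteq> z \<and> hyperplane (z \<inter> S) S then v z else 0)"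
  proof (rule sum.cong)
    fix z assume z: "z \<in> gens"
    show "(\<Sum>T | hyperplane T S. if T \<subseteq> z \<and> \<not> S \<subseteq> z then v z else 0) =
        (if \<not> S \<subseteq> z \<and> hyperplane (z \<inter> S) S then v z else 0)"
    proof (cases "S \<subseteq> z")
      case False
      then show ?thesis
        using card_hyperplanes_inside[OF isoD(1)[OF S] gens_subspace[OF z] False]
        by (simp add: sum.If_cases Int_def split: if_splits)
    qed simp
  qed simp
  finally have r: "(\<Sum>T | hyperplane T S. nsum v T - nsum v S) =
    (\<Sum>z\<in>gens. if \<not> S \<subseteq> z \<and> hyperplane (z \<inter> S) S then v z else 0)" .
  have "?c * nsum v S = (\<Sum>z\<in>gens. if S \<subseteq> z then ?c * v z else 0)"
    by (simp add: nsum_def sum_distrib_left sum.If_cases Int_def)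
  then show ?thesis
    unfolding l r
    by (simp add: card_adj_containing_cases[OF S] flip: sum.distrib)
       (rule sum.cong, auto)
qed

lemma gauss_mono: "j \<le> k \<Longrightarrow> gauss j \<le> gauss k"
  unfolding gauss_def by (rule sum_mono2) auto

lemma gauss_strict_mono: "j < k \<Longrightarrow> gauss j < gauss k"
proof -
  assume "j < k"
  then have "gauss (Suc j) \<le> gauss k" by (intro gauss_mono) simp
  moreover have "gauss j < gauss (Suc j)" by (simp add: gauss_simps)
  ultimately show ?thesis by simp
qed

text \<open>The first term of \<open>\<theta> k\<close> decreases weakly in \<open>k\<close> and the
  subtracted one increases strictly.\<close>

lemma \<theta>_inj:
  assumes "j < k"
  shows "\<theta> j \<noteq> \<theta> k"
proof
  assume "\<theta> j = \<theta> k"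
  then have "of_nat (t * gauss (D - j) + gauss k) = (of_nat (t * gauss (D - k) + gauss j) :: complex)"
    by (simp add: \<theta>_def algebra_simps)
  then have "t * gauss (D - j) + gauss k = t * gauss (D - k) + gauss j"
    using of_nat_eq_iff by blast
  moreover have "t * gauss (D - k) \<le> t * gauss (D - j)"
    using assms by (intro mult_le_mono2 gauss_mono) simp
  ultimately show False using gauss_strict_mono[OF assms] by linarith
qed

section \<open>The filtration by vanishing sums\<close>

definition vanish :: "nat \<Rightarrow> ('u set \<Rightarrow> complex) \<Rightarrow> bool" where
  "vanish k v \<longleftrightarrow> (\<forall>S. iso S \<and> dim S < k \<longrightarrow> nsum v S = 0)"

text \<open>The sums at the hyperplanes of \<open>S\<close> vanish, so the correction term in
  \<open>nsum_A\<close> reduces to \<open>- gauss (dim S)\<close> times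
  \<open>nsum v S\<close>.\<close>

lemma nsum_A_vanish:
  assumes v: "vanish (dim S) v" and S: "iso S"
  shows "nsum (mat_vec gens A v) S = \<theta> (dim S) * nsum v S"
proof -
  have "nsum v T = 0" if "hyperplane T S" for T
    using v that iso_subspace[OF S, of T] by (simp add: vanish_def hyperplane_def)
  then have "(\<Sum>T | hyperplane T S. nsum v T - nsum v S) = - (of_nat (gauss (dim S)) * nsum v S)"
    using card_hyperplanes[OF S] by (simp add: sum_negf)
  then show ?thesis
    unfolding nsum_A[OF S] by (simp add: \<theta>_def algebra_simps)
qed

lemma nsum_diff: "nsum (\<lambda>y. v y - w y) S = nsum v S - nsum w S"
  by (simp add: nsum_def sum_subtractf)

lemma nsum_scale: "nsum (\<lambda>y. c * v y) S = c * nsum v S"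
  by (simp add: nsum_def sum_distrib_left)

text \<open>In dimension \<open>k\<close> the two terms cancel by \<open>nsum_A_vanish\<close>;
  below it both are zero. Thus \<open>A - \<theta> k\<close> moves one step along the
  filtration.\<close>

lemma vanish_Suc:
  assumes v: "vanish k v"
  shows "vanish (Suc k) (\<lambda>y. mat_vec gens A v y - \<theta> k * v y)"
  unfolding vanish_def
proof (intro allI impI, elim conjE)
  fix S assume S: "iso S" "dim S < Suc k"
  have "vanish (dim S) v" using v S by (simp add: vanish_def)
  then have "nsum (mat_vec gens A v) S = \<theta> (dim S) * nsum v S"
    by (rule nsum_A_vanish[OF _ S(1)])
  moreover have "nsum v S = 0" if "dim S \<noteq> k"
    using v S that by (simp add: vanish_def)
  ultimately show "nsum (\<lambda>y. mat_vec gens A v y - \<theta> k * v y) S = 0"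
    by (cases "dim S = k") (auto simp: nsum_diff nsum_scale)
qed

text \<open>A generator is itself isotropic of dimension \<open>D\<close>, and the sum over the
  generators containing it is a single entry of \<open>v\<close>.\<close>

lemma vanish_all:
  assumes v: "v \<in> vecs gens" "vanish (Suc D) v"
  shows "v = (\<lambda>_. 0)"
proof
  fix y
  show "v y = 0"
  proof (cases "y \<in> gens")
    case True
    then have "{z. z \<in> gens \<and> y \<subseteq> z} = {y}" using gens_eq by blast
    then have "nsum v y = v y" by (simp add: nsum_def)
    then show ?thesis
      using v(2) True gens_iso dim_gens by (simp add: vanish_def)
  qed (use v in \<open>simp add: vecs_def\<close>)
qed

lemma mat_vec_A_vecs: "mat_vec gens A v \<in> vecs gens"
  using adjD(1) by (auto simp: vecs_def mat_vec_def A_def intro!: sum.neutral)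

text \<open>Downward induction: the image \<open>u\<close> of \<open>v\<close> under
  \<open>A - \<theta> k\<close> lies one step further in the filtration and is a sum of eigenvectors
  \<open>w j\<close>. Dividing each by \<open>\<theta> j - \<theta> k\<close> and subtracting them
  from \<open>v\<close> leaves an eigenvector for \<open>\<theta> k\<close>.\<close>

lemma eigen_decomposition:
  assumes "k \<le> Suc D" "v \<in> vecs gens" "vanish k v"
  shows "\<exists>w. (\<forall>j. w j \<in> eigenspace gens A (\<theta> j)) \<and> v = (\<lambda>y. \<Sum>j=k..D. w j y)"
  using assms
proof (induction k arbitrary: v rule: inc_induct)
  case base
  then have "v = (\<lambda>_. 0)" by (intro vanish_all)
  then show ?case
    by (intro exI[of _ "\<lambda>_ _. 0"]) (auto simp: eigenspace_def vecs_def mat_vec_def)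
next
  case (step k)
  define u where "u = (\<lambda>y. mat_vec gens A v y - \<theta> k * v y)"
  have "vanish (Suc k) u" unfolding u_def by (rule vanish_Suc) (rule step)
  moreover have "u \<in> vecs gens"
    using step(4) mat_vec_A_vecs[of v] by (simp add: u_def vecs_def)
  ultimately obtain w where w: "\<And>j. w j \<in> eigenspace gens A (\<theta> j)" "u = (\<lambda>y. \<Sum>j=Suc k..D. w j y)"
    using step.IH by blast
  define c where "c j = inverse (\<theta> j - \<theta> k)" for j
  define w0 where "w0 = (\<lambda>y. v y - (\<Sum>j=Suc k..D. c j * w j y))"
  have Aw: "mat_vec gens A (w j) = (\<lambda>y. \<theta> j * w j y)" for j
    using w(1) by (simp add: eigenspace_def)
  have "mat_vec gens A w0 y = \<theta> k * w0 y" for y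
  proof -
    have "(\<Sum>j=Suc k..D. c j * (\<theta> j * w j y)) - \<theta> k * (\<Sum>j=Suc k..D. c j * w j y)
        = (\<Sum>j=Suc k..D. (c j * (\<theta> j - \<theta> k)) * w j y)"
      by (simp add: sum_distrib_left algebra_simps flip: sum_subtractf)
    also have "\<dots> = (\<Sum>j=Suc k..D. w j y)"
    proof (rule sum.cong)
      fix j assume "j \<in> {Suc k..D}"
      then have "\<theta> j - \<theta> k \<noteq> 0" using \<theta>_inj[of k j] by simp
      then show "c j * (\<theta> j - \<theta> k) * w j y = w j y" by (simp add: c_def)
    qed simp
    also have "\<dots> = mat_vec gens A v y - \<theta> k * v y"
      using fun_cong[OF w(2), of y] by (simp add: u_def)
    finally show ?thesis
      unfolding w0_def by (simp add: mat_vec_diff_sum Aw algebra_simps)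
  qed
  moreover have "w0 \<in> vecs gens"
    using step(4) w(1) by (simp add: w0_def vecs_def eigenspace_def)
  ultimately have w0: "w0 \<in> eigenspace gens A (\<theta> k)"
    by (simp add: eigenspace_def fun_eq_iff)
  define w' where "w' j = (if j = k then w0 else (\<lambda>y. c j * w j y))" for j
  have "w' j \<in> eigenspace gens A (\<theta> j)" for j
    using w0 eigenspace_scale[OF w(1)] by (simp add: w'_def)
  moreover have "v = (\<lambda>y. \<Sum>j=k..D. w' j y)"
  proof
    fix y
    have "(\<Sum>j=k..D. w' j y) = w' k y + (\<Sum>j=Suc k..D. w' j y)"
      using step(2) by (simp add: sum.atLeast_Suc_atMost)
    also have "(\<Sum>j=Suc k..D. w' j y) = (\<Sum>j=Suc k..D. c j * w j y)"
      by (rule sum.cong) (auto simp: w'_def)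
    finally show "v y = (\<Sum>j=k..D. w' j y)" by (simp add: w'_def w0_def)
  qed
  ultimately show ?case by blast
qed

text \<open>On \<open>v\<close> the operator \<open>A - \<theta> j\<close> is multiplication by
  \<open>c - \<theta> j\<close>, so \<open>vanish_Suc\<close> pushes \<open>v\<close> along the
  filtration as long as this scalar is nonzero.\<close>

lemma eigenvector_vanish:
  assumes v: "v \<in> eigenspace gens A c" and "vanish k v" "k \<le> m" "\<And>j. k \<le> j \<Longrightarrow> j < m \<Longrightarrow> c \<noteq> \<theta> j"
  shows "vanish m v"
  using assms(3,4)
proof (induction m rule: dec_induct)
  case base
  show ?case by fact
next
  case (step j)
  then have vj: "vanish j v" and cj: "c \<noteq> \<theta> j" by auto
  have "vanish (Suc j) (\<lambda>y. (c - \<theta> j) * v y)"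
    using vanish_Suc[OF vj] v by (simp add: eigenspace_def left_diff_distrib)
  then show ?case using cj by (simp add: vanish_def nsum_scale)
qed

lemma eigenvector_zero:
  assumes "v \<in> eigenspace gens A c" "vanish k v" "k \<le> Suc D" "\<And>j. k \<le> j \<Longrightarrow> j \<le> D \<Longrightarrow> c \<noteq> \<theta> j"
  shows "v = (\<lambda>_. 0)"
  using assms eigenvector_vanish[OF assms(1,2,3)] by (intro vanish_all) (auto simp: eigenspace_def)

text \<open>Eigenvectors span \<open>vecs gens\<close>, in particular the unit vectors, which read
  off the columns. This is the uniqueness needed for \<open>primitive_idempotent\<close>.\<close>

lemma mats_eq_if_agree_on_eigenvectors:
  assumes F: "F \<in> mats gens" "G \<in> mats gens"
    and eq: "\<And>c v. v \<in> eigenspace gens A c \<Longrightarrow> mat_vec gens F v = mat_vec gens G v"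
  shows "F = G"
proof (intro ext)
  fix y z
  show "F y z = G y z"
  proof (cases "z \<in> gens")
    case True
    have "std_basis z \<in> vecs gens" using True by (auto simp: vecs_def std_basis_def)
    moreover have "vanish 0 (std_basis z)" by (simp add: vanish_def)
    ultimately obtain w where w: "\<And>j. w j \<in> eigenspace gens A (\<theta> j)" "std_basis z = (\<lambda>y. \<Sum>j=0..D. w j y)"
      using eigen_decomposition[of 0] by blast
    have "mat_vec gens F (std_basis z) = mat_vec gens G (std_basis z)"
      unfolding w(2) mat_vec_sum using eq[OF w(1)] by simp
    moreover have "mat_vec gens M (std_basis z) y = M y z" for M :: "'u set \<Rightarrow> 'u set \<Rightarrow> complex"
      using True by (simp add: mat_vec_def std_basis_def if_distrib[of "(*) _"] sum.delta cong: if_cong)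
    ultimately show ?thesis by metis
  qed (use F in \<open>simp add: mats_def\<close>)
qed

end

section \<open>The first primitive idempotent\<close>

context polar_rank
begin

definition qc :: complex where "qc = of_nat CARD('f)"
abbreviation tc :: complex where "tc \<equiv> of_nat t"
definition cc :: complex where "cc = tc * qc ^ (D - 1)"

text \<open>
  The constants for which \<open>\<alpha> q\<^bsup>D - i\<^esup> + \<beta>\<close> is the dual eigenvalue \<open>\<theta>\<^sup>*\<^sub>i\<close>; here \<open>cc\<close> is \<open>q\<^bsup>D + e\<^esup>\<close>.
\<close>

definition \<alpha> :: complex where
  "\<alpha> = (cc + qc) * qc * (cc + 1) / ((tc + qc) * qc ^ D * (qc - 1))"

definition \<beta> :: complex where
  "\<beta> = - (cc + qc) / (qc - 1)"

text \<open>For generators, \<open>card (y \<inter> z)\<close> is 1 plus \<open>CARD('f) - 1\<close>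
  times the number of common points, so this is a combination of
  \<open>N\<^sub>1\<^sup>T N\<^sub>1\<close> and the all-ones matrix.\<close>

definition E1 :: "'u set \<Rightarrow> 'u set \<Rightarrow> complex" where
  "E1 y z = (if y \<in> gens \<and> z \<in> gens
     then (\<alpha> * of_nat (card (y \<inter> z)) + \<beta>) / of_nat (card gens) else 0)"

lemma of_nat_card_field [simp]: "of_nat CARD('f) = qc"
  by (simp add: qc_def)

lemma qc_nz: "qc \<noteq> 0" "qc - 1 \<noteq> 0" "tc + qc \<noteq> 0" "cc + qc \<noteq> 0" "cc + 1 \<noteq> 0"
proof -
  have q2: "CARD('f) \<ge> 2" by (rule card_field_ge_2)
  show "qc \<noteq> 0" using q2 by (simp add: qc_def del: of_nat_card_field)
  have "of_nat (CARD('f) - 1) \<noteq> (0 :: complex)" using q2 unfolding of_nat_eq_0_iff by simp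
  then show "qc - 1 \<noteq> 0" using q2 by (simp add: of_nat_diff)
  have "of_nat (t + CARD('f)) \<noteq> (0 :: complex)" using q2 unfolding of_nat_eq_0_iff by simp
  then show "tc + qc \<noteq> 0" by simp
  have "of_nat (t * CARD('f) ^ (D - 1) + CARD('f)) \<noteq> (0 :: complex)"
    using q2 unfolding of_nat_eq_0_iff by simp
  then show "cc + qc \<noteq> 0" by (simp add: cc_def)
  have "of_nat (t * CARD('f) ^ (D - 1) + 1) \<noteq> (0 :: complex)"
    unfolding of_nat_eq_0_iff by simp
  then show "cc + 1 \<noteq> 0" by (simp add: cc_def add.commute)
qed

lemma qc_D: "qc ^ D = qc * qc ^ (D - 1)"
  using D_pos by (simp flip: power_Suc)

lemma card_gens_elem: "y \<in> gens \<Longrightarrow> card y = CARD('f) ^ D"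
  by (simp add: card_subspace gens_subspace dim_gens)

lemma gens_nonempty: "card gens \<noteq> 0"
proof -
  obtain M where "M \<in> gens" using iso_extend[OF iso_0] by blast
  then show ?thesis by auto
qed

lemma sum_nsum: "(\<Sum>p\<in>P. nsum v {p}) = (\<Sum>z\<in>gens. of_nat (card (P \<inter> z)) * v z)"
proof -
  have "nsum v {p} = (\<Sum>z\<in>gens. if p \<in> z then v z else 0)" for p
    by (simp add: nsum_def sum.If_cases Int_def)
  then have "(\<Sum>p\<in>P. nsum v {p}) = (\<Sum>z\<in>gens. \<Sum>p\<in>P. if p \<in> z then v z else 0)"
    by (simp add: sum.swap[of _ gens])
  then show ?thesis by (simp add: sum.If_cases Int_def)
qed

lemma nsum_span: "nsum v (span S) = nsum v S"
proof -
  have "y \<in> gens \<and> span S \<subseteq> y \<longleftrightarrow> y \<in> gens \<and> S \<subseteq> y" for y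
    using span_minimal[OF _ gens_subspace] span_superset[of S] by blast
  then show ?thesis by (simp add: nsum_def)
qed

lemma nsum_0: "nsum v {0} = (\<Sum>z\<in>gens. v z)"
proof -
  have "{y. y \<in> gens \<and> {0} \<subseteq> y} = gens" using gens_subspace subspace_0 by auto
  then show ?thesis by (simp add: nsum_def)
qed

lemma hyperplanes_of_line:
  assumes "subspace S" "dim S = 1"
  shows "{T. hyperplane T S} = {{0}}"
proof (rule equalityI; rule subsetI)
  fix T assume "T \<in> {T. hyperplane T S}"
  then have "subspace T" "dim T = 0" using assms by (auto simp: hyperplane_def)
  then show "T \<in> {{0}}" using subspace_0[of T] by auto
next
  fix T assume "T \<in> {{0 :: 'u}}"
  then show "T \<in> {T. hyperplane T S}"
    using assms subspace_0[of S] by (simp add: hyperplane_def)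
qed

lemma iso_line:
  assumes "iso S" "dim S = 1"
  obtains p where "p \<noteq> 0" "sing p" "S = span {p}"
proof -
  have "\<not> S \<subseteq> {0}" using assms(2) by (metis dim_eq_0 one_neq_zero)
  then obtain p where p: "p \<in> S" "p \<noteq> 0" by auto
  have "span {p} = S"
    using p assms isoD(1)[OF assms(1)]
    by (intro subspace_dim_equal span_minimal) auto
  then show ?thesis
    using that[OF p(2) isoD(2)[OF assms(1) p(1)]] by simp
qed

lemma nsum_A_0: "nsum (mat_vec gens A v) {0} = \<theta> 0 * nsum v {0}"
  using nsum_A_vanish[of "{0}" v] iso_0 by (simp add: vanish_def)

lemma nsum_A_point:
  assumes p: "p \<noteq> 0" "sing p"
  shows "nsum (mat_vec gens A v) {p} = \<theta> 1 * nsum v {p} + nsum v {0}"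
proof -
  have S: "iso (span {p})" "dim (span {p}) = 1"
    using p iso_span_singleton by auto
  then have "{T. hyperplane T (span {p})} = {{0}}"
    by (intro hyperplanes_of_line) auto
  then show ?thesis
    using nsum_A[OF S(1), of v] S(2) by (simp add: nsum_span \<theta>_def gauss_simps algebra_simps)
qed

lemma \<theta>_0_1: "\<theta> 0 - \<theta> 1 = cc + 1"
proof -
  have "gauss D = gauss (D - 1) + CARD('f) ^ (D - 1)"
    using D_pos gauss_simps(2)[of "D - 1"] by simp
  then show ?thesis by (simp add: \<theta>_def cc_def gauss_simps algebra_simps)
qed

lemma mat_vec_E1:
  assumes "y \<in> gens"
  shows "mat_vec gens E1 v y =
    (\<alpha> * (\<Sum>p\<in>y. nsum v {p}) + \<beta> * nsum v {0}) / of_nat (card gens)"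
proof -
  have "mat_vec gens E1 v y =
      (\<Sum>z\<in>gens. \<alpha> * (of_nat (card (y \<inter> z)) * v z) + \<beta> * v z) / of_nat (card gens)"
    using assms by (simp add: mat_vec_def E1_def sum_divide_distrib distrib_left mult_ac)
  then show ?thesis
    by (simp only: sum_nsum nsum_0 sum.distrib sum_distrib_left)
qed

lemma E1_vecs: "mat_vec gens E1 v \<in> vecs gens"
  by (auto simp: vecs_def mat_vec_def E1_def intro!: sum.neutral)

text \<open>Let n be the sum at \<open>{0}\<close>. Then \<open>c - \<theta> 0\<close> kills n, and
  \<open>c - \<theta> 1\<close> times each point sum is n. If n is 0, all these sums vanish;
  otherwise \<open>c = \<theta> 0\<close>, all point sums agree, and the terms with
  \<open>\<alpha>\<close> and \<open>\<beta>\<close> cancel.\<close>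

lemma E1_annihilates:
  assumes v: "v \<in> eigenspace gens A c" and c: "c \<noteq> \<theta> 1"
  shows "mat_vec gens E1 v = (\<lambda>_. 0)"
proof
  fix y
  show "mat_vec gens E1 v y = 0"
  proof (cases "y \<in> gens")
    case y: True
    let ?n = "nsum v {0}"
    have Av: "mat_vec gens A v = (\<lambda>y. c * v y)" using v by (simp add: eigenspace_def)
    have 0: "(c - \<theta> 0) * ?n = 0"
      using nsum_A_0[of v] by (simp add: Av nsum_scale algebra_simps)
    have 1: "(c - \<theta> 1) * nsum v {p} = ?n" if "p \<noteq> 0" "sing p" for p
      using nsum_A_point[OF that, of v] by (simp add: Av nsum_scale algebra_simps)
    have y0: "0 \<in> y" using gens_subspace[OF y] subspace_0 by blast
    have "(\<Sum>p\<in>y - {0}. nsum v {p}) = (\<Sum>p\<in>y - {0}. ?n / (c - \<theta> 1))"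
      using 1 isoD(2)[OF gens_iso[OF y]] c by (intro sum.cong) (auto simp: eq_divide_eq mult.commute)
    then have S: "(\<Sum>p\<in>y. nsum v {p}) = ?n + (qc ^ D - 1) * (?n / (c - \<theta> 1))"
      using y0 card_gens_elem[OF y] by (subst sum.remove[of _ 0]) (auto simp: of_nat_diff)
    show ?thesis
    proof (cases "?n = 0")
      case True
      then show ?thesis by (simp add: mat_vec_E1[OF y] S)
    next
      case False
      then have c0: "c - \<theta> 1 = cc + 1" using 0 \<theta>_0_1 by simp
      \<comment> \<open>This condition fixes the ratio of \<open>\<beta>\<close> to
        \<open>\<alpha>\<close>.\<close>
      have "\<alpha> * (1 + (qc ^ D - 1) / (cc + 1)) + \<beta> = 0"
      proof -
        have "\<alpha> * (1 + (qc ^ D - 1) / (cc + 1)) = \<alpha> * ((cc + qc ^ D) / (cc + 1))"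
          using qc_nz by (simp add: field_simps)
        also have "cc + qc ^ D = (tc + qc) * qc ^ (D - 1)"
          by (simp add: qc_D cc_def algebra_simps)
        also have "\<alpha> * ((tc + qc) * qc ^ (D - 1) / (cc + 1)) = (cc + qc) / (qc - 1)"
          unfolding \<alpha>_def qc_D using qc_nz by (simp add: divide_simps)
        finally show ?thesis by (simp add: \<beta>_def flip: add_divide_distrib)
      qed
      moreover have "\<alpha> * (?n + (qc ^ D - 1) * (?n / (cc + 1))) + \<beta> * ?n =
          (\<alpha> * (1 + (qc ^ D - 1) / (cc + 1)) + \<beta>) * ?n"
        by (simp add: algebra_simps)
      ultimately show ?thesis unfolding mat_vec_E1[OF y] S c0 by simp
    qed
  qed (use E1_vecs[of v] in \<open>simp add: vecs_def\<close>)
qed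

section \<open>Generators through points and lines\<close>

lemma nsum_one: "nsum (\<lambda>_. 1) S = of_nat (card {y \<in> gens. S \<subseteq> y})"
  by (simp add: nsum_def)

lemma nsum_A_one: "nsum (mat_vec gens A (\<lambda>_. 1)) S = of_nat (t * gauss D) * nsum (\<lambda>_. 1) S"
proof -
  have "mat_vec gens A (\<lambda>_. 1) y = of_nat (t * gauss D)" if y: "y \<in> gens" for y
  proof -
    have "mat_vec gens A (\<lambda>_. 1) y = of_nat (card {z \<in> gens. adj y z})"
      by (simp add: mat_vec_def A_def sum.If_cases Int_def)
    also have "{z \<in> gens. adj y z} = {z. adj z y \<and> {0} \<subseteq> z}"
      using adj_sym adjD(1) gens_subspace subspace_0 by auto
    also have "card \<dots> = t * gauss D"
      using card_adj_containing[OF y subspace_single_0] subspace_0[OF gens_subspace[OF y]] by simp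
    finally show ?thesis .
  qed
  then show ?thesis by (simp add: nsum_def)
qed

text \<open>Applied to the all-ones vector, an eigenvector for \<open>\<theta> 0\<close>,
  \<open>nsum_A_point\<close> becomes a linear equation for this number, with
  \<open>\<theta> 0 - \<theta> 1 = cc + 1\<close>.\<close>

lemma card_gens_point:
  assumes p: "p \<noteq> 0" "sing p"
  shows "(cc + 1) * of_nat (card {y \<in> gens. p \<in> y}) = of_nat (card gens)"
proof -
  let ?m = "nsum (\<lambda>_. 1) {p}"
  have "of_nat (t * gauss D) * ?m = \<theta> 1 * ?m + of_nat (card gens)"
    using nsum_A_point[OF p, of "\<lambda>_. 1"] nsum_A_one[of "{p}"] by (simp add: nsum_0)
  moreover have "of_nat (t * gauss D) = \<theta> 0" by (simp add: \<theta>_def gauss_simps)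
  ultimately have "(\<theta> 0 - \<theta> 1) * ?m = of_nat (card gens)" by (simp add: left_diff_distrib)
  then show ?thesis unfolding \<theta>_0_1 nsum_one by simp
qed

text \<open>The same method with \<open>nsum_A\<close>: the hyperplanes of \<open>S\<close> are its
  \<open>CARD('f) + 1\<close> points, each in equally many generators.\<close>

lemma card_gens_line:
  assumes S: "iso S" "dim S = 2" and p: "p \<noteq> 0" "sing p"
  shows "(cc + qc) * of_nat (card {y \<in> gens. S \<subseteq> y}) = qc * of_nat (card {y \<in> gens. p \<in> y})"
proof -
  let ?m = "nsum (\<lambda>_. 1) S" and ?m1 = "of_nat (card {y \<in> gens. p \<in> y}) :: complex"
  obtain M where M: "M \<in> gens" "S \<subseteq> M" using iso_extend[OF S(1)] by blast
  have "2 \<le> D" using dim_subset[OF M(2)] dim_gens[OF M(1)] S by simp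
  \<comment> \<open>Writing \<open>D\<close> as \<open>k + 2\<close> turns
    \<open>gauss D - gauss (D - 2)\<close> into q^k (1 + q); the factor 1 + q then cancels.\<close>
  then obtain k where k: "D = Suc (Suc k)" using nat_le_iff_add by auto
  have m1: "nsum (\<lambda>_. 1) T = ?m1" if T: "hyperplane T S" for T
  proof -
    have "iso T" "dim T = 1"
      using T S iso_subspace[OF S(1), of T] by (auto simp: hyperplane_def)
    then obtain r where r: "r \<noteq> 0" "sing r" "T = span {r}" by (rule iso_line)
    have "(cc + 1) * of_nat (card {y \<in> gens. r \<in> y}) = (cc + 1) * ?m1"
      using card_gens_point[OF p] card_gens_point[OF r(1,2)] by simp
    then have "of_nat (card {y \<in> gens. r \<in> y}) = ?m1" using qc_nz by simp
    moreover have "nsum (\<lambda>_. 1) T = of_nat (card {y \<in> gens. r \<in> y})"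
      unfolding r(3) nsum_span unfolding nsum_one by simp
    ultimately show ?thesis by simp
  qed
  have "card {T. hyperplane T S} = 1 + CARD('f)"
    using card_hyperplanes[OF S(1)] S by (simp add: numeral_2_eq_2 gauss_simps)
  then have "(\<Sum>T | hyperplane T S. nsum (\<lambda>_. 1) T - ?m) = (1 + qc) * (?m1 - ?m)"
    by (simp add: m1)
  then have e: "of_nat (t * gauss D) * ?m = of_nat (t * gauss (D - 2)) * ?m + (1 + qc) * (?m1 - ?m)"
    using nsum_A[OF S(1), of "\<lambda>_. 1"] nsum_A_one[of S] S by simp
  have "gauss D = gauss k + CARD('f) ^ k * (1 + CARD('f))"
    by (simp add: k gauss_simps algebra_simps)
  moreover have "D - 2 = k" by (simp add: k)
  ultimately have "tc * (qc ^ k * (1 + qc)) * ?m = (1 + qc) * (?m1 - ?m)"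
    using e by (simp add: algebra_simps)
  then have "(1 + qc) * (tc * qc ^ k * ?m) = (1 + qc) * (?m1 - ?m)"
    by (simp add: algebra_simps)
  moreover have "1 + qc \<noteq> 0"
    unfolding qc_def by (metis of_nat_1 of_nat_add of_nat_eq_0_iff add_is_0 one_neq_zero)
  ultimately have "tc * qc ^ k * ?m = ?m1 - ?m" using mult_left_cancel[of "1 + qc"] by blast
  then have "?m1 = (1 + tc * qc ^ k) * ?m" by (simp add: algebra_simps)
  moreover have "D - 1 = Suc k" by (simp add: k)
  ultimately have "qc * ?m1 = (cc + qc) * ?m" by (simp add: cc_def algebra_simps)
  then show ?thesis unfolding nsum_one by simp
qed

text \<open>Up to a scalar, the image under \<open>E1\<close> has at \<open>y\<close> the sum of
  \<open>nsum v {p}\<close> over \<open>p\<close> in \<open>y\<close>. A \<open>p\<close> with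
  nonzero term lies in \<open>\<theta> 1 + 1\<close> neighbours of \<open>y\<close> if it lies in
  \<open>y\<close> and in one otherwise, and the sum over all \<open>p\<close> is zero.\<close>

lemma E1_eigenspace:
  assumes v: "v \<in> eigenspace gens A (\<theta> 1)"
  shows "mat_vec gens E1 v \<in> eigenspace gens A (\<theta> 1)" "nsum v {0} = 0"
proof -
  have Av: "mat_vec gens A v = (\<lambda>y. \<theta> 1 * v y)" using v by (simp add: eigenspace_def)
  have "(\<theta> 0 - \<theta> 1) * nsum v {0} = 0"
    using nsum_A_0[of v] unfolding Av nsum_scale left_diff_distrib by auto
  then show n0: "nsum v {0} = 0" using qc_nz(5) unfolding \<theta>_0_1 by simp
  let ?w = "\<lambda>p. nsum v {p}"
  let ?k = "\<alpha> / of_nat (card gens)"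
  have u: "mat_vec gens E1 v y = ?k * (\<Sum>p\<in>y. ?w p)" if "y \<in> gens" for y
    using mat_vec_E1[OF that, of v] n0 by simp
  have w0: "?w p = 0" if "\<not> sing p" for p
  proof -
    have "{y. y \<in> gens \<and> {p} \<subseteq> y} = {}" using that isoD(2)[OF gens_iso] by auto
    then show ?thesis unfolding nsum_def by (simp only: sum.empty)
  qed
  \<comment> \<open>Each generator contributes once for each of its \<open>CARD('f) ^ D\<close>
    vectors, so the total is a multiple of \<open>nsum v {0}\<close>.\<close>
  have "(\<Sum>p\<in>UNIV. ?w p) = (\<Sum>z\<in>gens. qc ^ D * v z)"
    unfolding sum_nsum using card_gens_elem by (intro sum.cong) auto
  also have "\<dots> = qc ^ D * nsum v {0}" unfolding nsum_0 by (simp only: sum_distrib_left)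
  finally have tot: "(\<Sum>p\<in>UNIV. ?w p) = 0" using n0 by simp
  have "mat_vec gens A (mat_vec gens E1 v) y = \<theta> 1 * mat_vec gens E1 v y" for y
  proof (cases "y \<in> gens")
    case y: True
    have cnt: "of_nat (card {z. adj y z \<and> p \<in> z}) * ?w p =
        ?w p + (if p \<in> y then \<theta> 1 * ?w p else 0)" for p
    proof (cases "p \<noteq> 0 \<and> sing p")
      case True
      then have S: "iso (span {p})" "dim (span {p}) = 1"
        using iso_span_singleton by auto
      have sub: "span {p} \<subseteq> z \<longleftrightarrow> p \<in> z" if "z \<in> gens" for z
        using span_minimal[of "{p}" z] gens_subspace[OF that] span_base[of p "{p}"] by auto
      have "{z. adj y z \<and> p \<in> z} = {z. adj z y \<and> span {p} \<subseteq> z}"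
        using adj_sym sub adjD(1) by blast
      then have c: "card {z. adj y z \<and> p \<in> z} =
          (if p \<in> y then t * gauss (D - 1) else if hyperplane (y \<inter> span {p}) (span {p}) then 1 else 0)"
        using card_adj_containing_cases[OF S(1) y] S(2) sub[OF y] by simp
      have "hyperplane (y \<inter> span {p}) (span {p})" if "p \<notin> y"
      proof -
        have "subspace (y \<inter> span {p})" by (simp add: gens_subspace[OF y] subspace_inter)
        moreover have "\<not> 1 \<le> dim (y \<inter> span {p})"
        proof
          assume "1 \<le> dim (y \<inter> span {p})"
          then have "y \<inter> span {p} = span {p}"
            using calculation S(2) by (intro subspace_dim_equal) (simp_all only: subspace_span, auto)
          then show False using that span_base[of p "{p}"] by auto
        qed
        ultimately show ?thesis
          unfolding hyperplane_def S(2) by (simp only: not_le less_one) simp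
      qed
      then show ?thesis
        using c by (simp add: \<theta>_def gauss_simps algebra_simps)
    next
      case False
      then have "?w p = 0" using w0 n0 by auto
      then show ?thesis by simp
    qed
    have "mat_vec gens A (mat_vec gens E1 v) y = (\<Sum>z\<in>gens. A y z * (?k * (\<Sum>p\<in>z. ?w p)))"
      unfolding mat_vec_def[of gens A] using u by (intro sum.cong) auto
    also have "\<dots> = ?k * (\<Sum>z\<in>gens. \<Sum>p\<in>UNIV. if adj y z \<and> p \<in> z then ?w p else 0)"
    proof -
      have "A y z * (?k * (\<Sum>p\<in>z. ?w p)) = ?k * (\<Sum>p\<in>UNIV. if adj y z \<and> p \<in> z then ?w p else 0)" for z
        by (simp add: A_def sum.If_cases)
      then show ?thesis by (simp only: sum_distrib_left[symmetric])
    qed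
    also have "(\<Sum>z\<in>gens. \<Sum>p\<in>UNIV. if adj y z \<and> p \<in> z then ?w p else 0) =
        (\<Sum>p\<in>UNIV. \<Sum>z\<in>gens. if adj y z \<and> p \<in> z then ?w p else 0)"
      by (rule sum.swap)
    also have "\<dots> = (\<Sum>p\<in>UNIV. of_nat (card {z. adj y z \<and> p \<in> z}) * ?w p)"
    proof (rule sum.cong)
      fix p
      have "gens \<inter> {z. adj y z \<and> p \<in> z} = {z. adj y z \<and> p \<in> z}" using adjD(2) by blast
      then show "(\<Sum>z\<in>gens. if adj y z \<and> p \<in> z then ?w p else 0) =
          of_nat (card {z. adj y z \<and> p \<in> z}) * ?w p"
        by (simp add: sum.If_cases)
    qed simp
    also have "\<dots> = (\<Sum>p\<in>UNIV. ?w p) + (\<Sum>p\<in>UNIV. if p \<in> y then \<theta> 1 * ?w p else 0)"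
      unfolding cnt by (rule sum.distrib)
    also have "\<dots> = \<theta> 1 * (\<Sum>p\<in>y. ?w p)"
      unfolding tot by (simp add: sum.If_cases sum_distrib_left)
    finally show ?thesis using u[OF y] by simp
  next
    case False
    then show ?thesis using mat_vec_A_vecs E1_vecs[of v] by (simp add: vecs_def)
  qed
  then show "mat_vec gens E1 v \<in> eigenspace gens A (\<theta> 1)"
    using E1_vecs by (simp add: eigenspace_def fun_eq_iff)
qed

text \<open>Multiples of \<open>p\<close>, zero included, lie in every generator through
  \<open>p\<close>; any other singular \<open>r\<close> orthogonal to \<open>p\<close> spans an
  isotropic plane with it, counted by \<open>card_gens_line\<close>; the remaining \<open>r\<close>
  share no generator with \<open>p\<close>.\<close>

lemma card_gens_two_points:
  assumes p: "p \<noteq> 0" "sing p"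
  shows "of_nat (card {y \<in> gens. p \<in> y \<and> r \<in> y}) =
    (if r \<in> span {p} then 1 else if sing r \<and> r \<in> perp {p} then qc / (cc + qc) else 0) *
    (of_nat (card {y \<in> gens. p \<in> y}) :: complex)"
proof -
  consider "r \<in> span {p}" | "r \<notin> span {p}" "sing r" "r \<in> perp {p}"
    | "r \<notin> span {p}" "\<not> (sing r \<and> r \<in> perp {p})" by blast
  then show ?thesis
  proof cases
    case 1
    then have "{y \<in> gens. p \<in> y \<and> r \<in> y} = {y \<in> gens. p \<in> y}"
      using span_minimal[of "{p}"] gens_subspace by blast
    then show ?thesis using 1 by simp
  next
    case 2
    have "r \<in> perp (span {p})" using 2 by (simp add: perp_span)
    then have S: "iso (span (insert r (span {p})))" "dim (span (insert r (span {p}))) = 2"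
      using iso_span_insert[OF iso_span_singleton[OF p(2)] 2(2)]
        dim_span_insert[OF subspace_span 2(1)] p by auto
    have "{y \<in> gens. p \<in> y \<and> r \<in> y} = {y \<in> gens. span (insert r (span {p})) \<subseteq> y}"
    proof (rule Collect_cong, rule conj_cong[OF refl])
      fix y assume "y \<in> gens"
      then have sy: "subspace y" by (rule gens_subspace)
      show "p \<in> y \<and> r \<in> y \<longleftrightarrow> span (insert r (span {p})) \<subseteq> y"
        using span_insert_least[OF sy, of r "span {p}"] span_minimal[of "{p}" y] sy
          span_superset[of "insert r (span {p})"] span_base[of p "{p}"] by blast
    qed
    then show ?thesis
      using card_gens_line[OF S p] 2 qc_nz by (simp add: field_simps)
  next
    case 3
    have "{y \<in> gens. p \<in> y \<and> r \<in> y} = {}"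
      using 3 isoD(2,3)[OF gens_iso] by (auto simp: perp_def subset_iff)
    then show ?thesis using 3 by auto
  qed
qed

text \<open>Expanding \<open>E1\<close> weights the point sums by
  \<open>card_gens_two_points\<close>, so only the sums over the multiples of \<open>p\<close> and
  over the singular vectors orthogonal to \<open>p\<close> matter; both are multiples of
  \<open>nsum v {p}\<close>.\<close>

lemma nsum_E1:
  assumes v: "v \<in> eigenspace gens A (\<theta> 1)" and p: "p \<noteq> 0" "sing p"
  shows "nsum (mat_vec gens E1 v) {p} = nsum v {p}"
proof -
  let ?w = "\<lambda>p. nsum v {p}"
  let ?k = "\<alpha> / of_nat (card gens)"
  let ?m = "of_nat (card {y \<in> gens. p \<in> y}) :: complex"
  let ?L = "span {p}" and ?P = "{r. sing r \<and> r \<in> perp {p}}"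
  have n0: "nsum v {0} = 0" by (rule E1_eigenspace(2)[OF v])
  have u: "mat_vec gens E1 v y = ?k * (\<Sum>p\<in>y. ?w p)" if "y \<in> gens" for y
    using mat_vec_E1[OF that, of v] n0 by simp
  have LP: "?L \<subseteq> ?P"
    using iso_span_singleton[OF p(2)] perp_antimono[of "{p}" ?L] span_superset[of "{p}"]
    by (auto simp: iso_def)
  have "?w r = ?w p" if r: "r \<in> ?L - {0}" for r
  proof -
    have "span {r} = ?L"
      using r p by (intro subspace_dim_equal span_minimal) auto
    then show ?thesis using nsum_span[of v "{r}"] nsum_span[of v "{p}"] by simp
  qed
  then have "(\<Sum>r\<in>?L. ?w r) = of_nat (card ?L - 1) * ?w p"
    using n0 by (subst sum.remove[of _ 0]) (auto simp: span_zero)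
  moreover have "card ?L = CARD('f)" using card_subspace[of ?L] p by simp
  ultimately have sL: "(\<Sum>r\<in>?L. ?w r) = (qc - 1) * ?w p"
    using card_field_ge_2 by (simp add: of_nat_diff)
  \<comment> \<open>A generator lies inside \<open>perp {p}\<close> if it contains \<open>p\<close>,
    and otherwise meets it in a hyperplane.\<close>
  have "of_nat (card (?P \<inter> z)) * v z = qc ^ (D - 1) * v z +
      (if p \<in> z then qc ^ (D - 1) * (qc - 1) * v z else 0)" if z: "z \<in> gens" for z
  proof -
    have Pz: "?P \<inter> z = z \<inter> perp {p}" using isoD(2)[OF gens_iso[OF z]] by auto
    show ?thesis
    proof (cases "p \<in> z")
      case True
      then have "z \<subseteq> perp {p}"
        using isoD(3)[OF gens_iso[OF z]] perp_antimono[of "{p}" z] by auto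
      then have "z \<inter> perp {p} = z" by auto
      then show ?thesis
        using True card_gens_elem[OF z] Pz by (simp add: qc_D algebra_simps)
    next
      case False
      then have "p \<notin> perp z" using gens_absorb[OF z p(2)] by auto
      then obtain a where a: "a \<in> z" "B p a \<noteq> 0" by (auto simp: perp_def)
      then have "B a p \<noteq> 0" using B_refl by blast
      then have "hyperplane (z \<inter> perp {p}) z"
        by (rule hyperplane_perp_singleton[OF gens_subspace[OF z] a(1)])
      then have "card (z \<inter> perp {p}) = CARD('f) ^ (D - 1)"
        using card_subspace[of "z \<inter> perp {p}"] dim_gens[OF z] by (auto simp: hyperplane_def)
      then show ?thesis using False Pz by simp
    qed
  qed
  then have "(\<Sum>r\<in>?P. ?w r) =
      (\<Sum>z\<in>gens. qc ^ (D - 1) * v z + (if p \<in> z then qc ^ (D - 1) * (qc - 1) * v z else 0))"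
    unfolding sum_nsum by (intro sum.cong) auto
  also have "\<dots> = qc ^ (D - 1) * nsum v {0} + qc ^ (D - 1) * (qc - 1) * ?w p"
    unfolding nsum_0 by (simp add: sum.distrib sum_distrib_left nsum_def sum.If_cases Int_def)
  finally have sP: "(\<Sum>r\<in>?P. ?w r) = qc ^ (D - 1) * (qc - 1) * ?w p" using n0 by simp
  have "nsum (mat_vec gens E1 v) {p} = (\<Sum>y | y \<in> gens \<and> p \<in> y. ?k * (\<Sum>r\<in>y. ?w r))"
    unfolding nsum_def[of "mat_vec gens E1 v"] using u by (intro sum.cong) auto
  also have "\<dots> = ?k * (\<Sum>y | y \<in> gens \<and> p \<in> y. \<Sum>r\<in>UNIV. if r \<in> y then ?w r else 0)"
    by (simp add: sum_distrib_left sum.If_cases)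
  also have "(\<Sum>y | y \<in> gens \<and> p \<in> y. \<Sum>r\<in>UNIV. if r \<in> y then ?w r else 0) =
      (\<Sum>r\<in>UNIV. \<Sum>y | y \<in> gens \<and> p \<in> y. if r \<in> y then ?w r else 0)"
    by (rule sum.swap)
  also have "\<dots> = (\<Sum>r\<in>UNIV. of_nat (card {y \<in> gens. p \<in> y \<and> r \<in> y}) * ?w r)"
    by (simp add: sum.If_cases Int_def conj_assoc)
  \<comment> \<open>Since \<open>?L \<subseteq> ?P\<close>, the weight, proportional to 1 on
    \<open>?L\<close> and to \<open>qc / (cc + qc)\<close> on the rest of \<open>?P\<close>, splits
    into two constant weights.\<close>
  also have "\<dots> = (\<Sum>r\<in>UNIV. ?m * (1 - qc / (cc + qc)) * (if r \<in> ?L then ?w r else 0) +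
      ?m * (qc / (cc + qc)) * (if r \<in> ?P then ?w r else 0))"
    unfolding card_gens_two_points[OF p]
    using LP by (intro sum.cong) (auto simp: algebra_simps)
  also have "\<dots> = ?m * (1 - qc / (cc + qc)) * (\<Sum>r\<in>?L. ?w r) + ?m * (qc / (cc + qc)) * (\<Sum>r\<in>?P. ?w r)"
    unfolding sum.distrib sum_distrib_left[symmetric] by (simp add: sum.If_cases)
  also have "\<dots> = ?m * (qc - 1) * (1 - qc / (cc + qc) + qc / (cc + qc) * qc ^ (D - 1)) * ?w p"
  proof -
    have "m * (1 - d) * ((qc - 1) * w) + m * d * (x * (qc - 1) * w) = m * (qc - 1) * (1 - d + d * x) * w"
      for m d x w :: complex by (simp add: algebra_simps)
    then show ?thesis unfolding sL sP .
  qed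
  also have "1 - qc / (cc + qc) + qc / (cc + qc) * qc ^ (D - 1) = (tc + qc) * qc ^ (D - 1) / (cc + qc)"
  proof -
    have "1 - qc / d + qc / d * x = (d - qc + qc * x) / d" if "d \<noteq> 0" for d x :: complex
      using that by (simp add: diff_divide_distrib add_divide_distrib)
    from this[OF qc_nz(4)] have "1 - qc / (cc + qc) + qc / (cc + qc) * qc ^ (D - 1) =
        (cc + qc * qc ^ (D - 1)) / (cc + qc)"
      by simp
    also have "cc + qc * qc ^ (D - 1) = (tc + qc) * qc ^ (D - 1)"
      by (simp add: cc_def algebra_simps)
    finally show ?thesis .
  qed
  also have "?k * (?m * (qc - 1) * ((tc + qc) * qc ^ (D - 1) / (cc + qc)) * ?w p) = ?w p"
  proof -
    \<comment> \<open>This identity accounts for the normalization of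
      \<open>\<alpha>\<close>.\<close>
    have "\<alpha> * (qc - 1) * ((tc + qc) * qc ^ (D - 1) / (cc + qc)) = cc + 1"
      unfolding \<alpha>_def qc_D using qc_nz by (simp add: divide_simps)
    then have "(\<alpha> * (qc - 1) * ((tc + qc) * qc ^ (D - 1) / (cc + qc))) * ?m = (cc + 1) * ?m"
      by simp
    then have "\<alpha> * (?m * (qc - 1) * ((tc + qc) * qc ^ (D - 1) / (cc + qc))) = (cc + 1) * ?m"
      by (simp only: mult_ac)
    then have key: "\<alpha> * (?m * (qc - 1) * ((tc + qc) * qc ^ (D - 1) / (cc + qc))) = of_nat (card gens)"
      using card_gens_point[OF p] by simp
    have "\<alpha> / x * (y * w) = \<alpha> * y / x * w" for x y w :: complex
      by simp
    then show ?thesis using gens_nonempty by (simp only: key) simp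
  qed
  finally show ?thesis .
qed

text \<open>The difference of the two sides is an eigenvector for \<open>\<theta> 1\<close> whose
  sums vanish at \<open>{0}\<close> and at all points; since \<open>\<theta> 1\<close> differs from
  all later \<open>\<theta> j\<close>, the filtration makes it zero.\<close>

lemma E1_fixes:
  assumes v: "v \<in> eigenspace gens A (\<theta> 1)"
  shows "mat_vec gens E1 v = v"
proof -
  let ?u = "\<lambda>y. mat_vec gens E1 v y - v y"
  note Ev = E1_eigenspace(1)[OF v]
  have eig: "?u \<in> eigenspace gens A (\<theta> 1)"
    using v Ev by (simp add: eigenspace_def vecs_def mat_vec_diff right_diff_distrib)
  have "vanish 2 ?u"
    unfolding vanish_def
  proof (intro allI impI, elim conjE)
    fix S assume S: "iso S" "dim S < 2"
    show "nsum ?u S = 0"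
    proof (cases "dim S = 0")
      case True
      then have "S = {0}" using subspace_0[OF isoD(1)[OF S(1)]] by auto
      then show ?thesis using E1_eigenspace(2)[OF eig] by simp
    next
      case False
      then have "dim S = 1" using S by linarith
      then obtain p where p: "p \<noteq> 0" "sing p" "S = span {p}" using iso_line[OF S(1)] by blast
      then show ?thesis using nsum_E1[OF v p(1,2)] by (simp add: nsum_span nsum_diff)
    qed
  qed
  moreover have "2 \<le> Suc D" using D_pos by simp
  moreover have "\<theta> 1 \<noteq> \<theta> j" if "2 \<le> j" for j using \<theta>_inj[of 1 j] that by simp
  ultimately have "?u = (\<lambda>_. 0)"
    by (intro eigenvector_zero[OF eig]) auto
  then show ?thesis by (simp add: fun_eq_iff)
qed

text \<open>Uniqueness in the definite description holds because any two candidates agree on every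
  eigenvector.\<close>

lemma primitive_idempotent_1: "primitive_idempotent gens A (\<theta> 1) = E1"
  unfolding primitive_idempotent_def
proof (rule the_equality)
  show *: "E1 \<in> mats gens \<and> (\<forall>v\<in>eigenspace gens A (\<theta> 1). mat_vec gens E1 v = v) \<and>
      (\<forall>c v. c \<noteq> \<theta> 1 \<and> v \<in> eigenspace gens A c \<longrightarrow> mat_vec gens E1 v = (\<lambda>_. 0))"
    using E1_fixes E1_annihilates by (auto simp: mats_def E1_def)
  fix E
  assume E: "E \<in> mats gens \<and> (\<forall>v\<in>eigenspace gens A (\<theta> 1). mat_vec gens E v = v) \<and>
      (\<forall>c v. c \<noteq> \<theta> 1 \<and> v \<in> eigenspace gens A c \<longrightarrow> mat_vec gens E v = (\<lambda>_. 0))"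
  show "E = E1"
  proof (rule mats_eq_if_agree_on_eigenvectors)
    fix c v assume "v \<in> eigenspace gens A c"
    then show "mat_vec gens E v = mat_vec gens E1 v"
      using * E by (cases "c = \<theta> 1") auto
  qed (use * E in auto)
qed

end

section \<open>Quadratic, symplectic and Hermitian geometries\<close>

lemma sum_bound_attained:
  fixes g :: "'a \<Rightarrow> nat"
  assumes "finite C" "card C \<le> n" "\<And>c. c \<in> C \<Longrightarrow> g c \<le> m" "sum g C = n * m" "c \<in> C"
  shows "g c = m"
proof (rule ccontr)
  assume "g c \<noteq> m"
  then have "g c < m" using assms(3,5) le_neq_implies_less by blast
  then have "sum g C < (\<Sum>c\<in>C. m)"
    using assms by (intro sum_strict_mono_ex1) auto
  also have "\<dots> \<le> n * m" using assms(2) by simp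
  finally show False using assms(4) by simp
qed

lemma card_roots_le:
  fixes p :: "'a::idom poly"
  assumes "p \<noteq> 0" "degree p \<le> n" "\<And>x. P x \<Longrightarrow> poly p x = 0"
  shows "card {x. P x} \<le> n"
proof -
  have "card {x. P x} \<le> card {x. poly p x = 0}"
    using assms by (intro card_mono poly_roots_finite) auto
  then show ?thesis using card_poly_roots_bound[OF assms(1)] assms(2) by linarith
qed

lemma card_power_eq_le:
  fixes b :: "'a::idom"
  assumes "n > 0"
  shows "card {x. x ^ n = b} \<le> n"
proof (rule card_roots_le)
  let ?p = "monom 1 n - [:b:] :: 'a poly"
  have "coeff ?p n = 1" using assms by (simp add: coeff_pCons split: nat.splits)
  then show "?p \<noteq> 0" by (metis coeff_0 one_neq_zero)
  show "degree ?p \<le> n" by (intro degree_diff_le) (auto simp: degree_monom_le)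
qed (simp add: poly_monom)

lemma card_power_plus_linear_le:
  fixes a b :: "'a::idom"
  assumes "n > 1"
  shows "card {x. x ^ n + a * x = b} \<le> n"
proof (rule card_roots_le)
  let ?p = "monom 1 n + [:- b, a:] :: 'a poly"
  have "coeff ?p n = 1" using assms by (simp add: coeff_pCons split: nat.splits)
  then show "?p \<noteq> 0" by (metis coeff_0 one_neq_zero)
  show "degree ?p \<le> n" using assms by (intro degree_add_le) (auto simp: degree_monom_le)
qed (auto simp: poly_monom algebra_simps)

lemma power_card_field:
  fixes a :: "'f::{field, finite}"
  shows "a ^ CARD('f) = a"
proof (cases "a = 0")
  case False
  have "bij_betw ((*) a) (UNIV - {0}) (UNIV - {0})"
    using False by (intro bij_betw_byWitness[of _ "\<lambda>y. y / a"]) auto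
  then have "(\<Prod>y\<in>UNIV - {0}. a * y) = \<Prod>(UNIV - {0 :: 'f})"
    by (rule prod.reindex_bij_betw)
  moreover have "\<Prod>(UNIV - {0 :: 'f}) \<noteq> 0" by simp
  ultimately have "a ^ (CARD('f) - 1) = 1"
    by (simp add: prod.distrib)
  then have "a * a ^ (CARD('f) - 1) = a" by simp
  then show ?thesis by (simp flip: power_Suc)
qed (simp add: zero_power)

lemma CHAR_eq_prime:
  assumes "CARD('f::{field, finite}) = p ^ k" "prime p"
  shows "CHAR('f) = p"
proof -
  have "(\<Sum>x\<in>UNIV. x + 1) = (\<Sum>x\<in>(UNIV :: 'f set). x)"
    by (rule sum.reindex_bij_betw) (rule bij_betw_byWitness[of _ "\<lambda>x. x - 1"], auto)
  then have "of_nat CARD('f) = (0 :: 'f)" by (simp add: sum.distrib)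
  then have "CHAR('f) dvd p ^ k" using assms(1) of_nat_eq_0_iff_char_dvd by metis
  moreover have "prime CHAR('f)"
    by (rule prime_CHAR_semidom) (simp add: finite_imp_CHAR_pos)
  ultimately show ?thesis
    using assms(2) by (metis prime_dvd_power primes_dvd_imp_eq)
qed

text \<open>The trace \<open>b + b ^ r\<close> takes values in the fixed elements of
  \<open>a \<mapsto> a ^ r\<close>, at most \<open>r\<close> many, and each fibre has at most
  \<open>r\<close> elements, by counting roots. As the field has order \<open>r * r\<close>, every
  bound is attained.\<close>

lemma card_trace_fibre:
  fixes k :: "'f::{field, finite}"
  assumes card: "CARD('f) = r * r" and r: "r > 1" and k: "k ^ r = k"
    and add: "\<And>a b :: 'f. (a + b) ^ r = a ^ r + b ^ r"
  shows "card {b. b + b ^ r = k} = r"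
proof -
  let ?K = "{k :: 'f. k ^ r = k}"
  have idem: "(b ^ r) ^ r = b" for b :: 'f
    using power_card_field[of b] by (simp add: card power_mult)
  have "card ?K \<le> r"
    using card_power_plus_linear_le[OF r, of "-1" "0 :: 'f"] by simp
  moreover have "card {b. b + b ^ r = k} \<le> r" for k :: 'f
    using card_power_plus_linear_le[OF r, of 1 k] by (simp add: add.commute)
  moreover have "(\<Sum>k\<in>?K. card {b. b + b ^ r = k}) = r * r"
    using card_eq_sum_fibers[of UNIV ?K "\<lambda>b. b + b ^ r"] card
    by (simp add: add idem add.commute)
  ultimately show ?thesis
    using sum_bound_attained[of ?K r "\<lambda>k. card {b. b + b ^ r = k}" r k] k by simp
qed

text \<open>The same pigeonhole argument for the norm \<open>b ^ (r + 1)\<close>: at most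
  \<open>r - 1\<close> nonzero fixed elements, fibres of size at most \<open>r + 1\<close>, and
  \<open>(r - 1) * (r + 1)\<close> nonzero field elements.\<close>

lemma norm_surjective:
  fixes k :: "'f::{field, finite}"
  assumes card: "CARD('f) = r * r" and r: "r > 1" and k: "k ^ r = k" "k \<noteq> 0"
  obtains b where "b ^ (r + 1) = k"
proof -
  let ?K = "{k :: 'f. k ^ r = k \<and> k \<noteq> 0}"
  let ?G = "UNIV - {0 :: 'f}"
  have idem: "(b ^ r) ^ r = b" for b :: 'f
    using power_card_field[of b] by (simp add: card power_mult)
  have "k ^ (r - 1) = 1" if "k \<in> ?K" for k
  proof -
    have "k * k ^ (r - 1) = k * 1" using that r by (simp flip: power_Suc)
    then show ?thesis using that by simp
  qed
  then have "card ?K \<le> card {k :: 'f. k ^ (r - 1) = 1}" by (intro card_mono) auto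
  also have "\<dots> \<le> r - 1" using r by (intro card_power_eq_le) simp
  finally have "card ?K \<le> r - 1" .
  moreover have "card {b \<in> ?G. b ^ (r + 1) = k} \<le> r + 1" for k
  proof -
    have "card {b \<in> ?G. b ^ (r + 1) = k} \<le> card {b. b ^ (r + 1) = k}"
      by (intro card_mono) auto
    then show ?thesis using card_power_eq_le[of "r + 1" k] by simp
  qed
  moreover have "(\<Sum>k\<in>?K. card {b \<in> ?G. b ^ (r + 1) = k}) = (r - 1) * (r + 1)"
  proof -
    have "b ^ (r + 1) \<in> ?K" if "b \<in> ?G" for b
    proof -
      have "(b ^ (r + 1)) ^ r = (b ^ r) ^ r * b ^ r"
        by (simp add: power_mult_distrib power_add mult.commute)
      then show ?thesis using idem that by simp
    qed
    then have "card ?G = (\<Sum>k\<in>?K. card {b \<in> ?G. b ^ (r + 1) = k})"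
      by (intro card_eq_sum_fibers) auto
    moreover have "card ?G = (r - 1) * (r + 1)"
      using r by (simp add: card_Diff_subset card algebra_simps)
    ultimately show ?thesis by simp
  qed
  ultimately have "card {b \<in> ?G. b ^ (r + 1) = k} = r + 1"
    using sum_bound_attained[of ?K "r - 1" "\<lambda>k. card {b \<in> ?G. b ^ (r + 1) = k}" "r + 1" k] k by simp
  then have "{b \<in> ?G. b ^ (r + 1) = k} \<noteq> {}" by (metis Suc_eq_plus1 card.empty nat.distinct(1))
  then show ?thesis using that by blast
qed

text \<open>Squaring is at most two to one, and only 0 has square 0.\<close>

lemma card_squares: "CARD('f) + 1 \<le> 2 * card (range (\<lambda>x :: 'f::{field, finite}. x ^ 2))"
proof -
  let ?S = "range (\<lambda>x :: 'f. x ^ 2)"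
  have fib: "card {x. x ^ 2 = c} \<le> 2" for c :: 'f
    by (rule card_power_eq_le) simp
  have "CARD('f) = (\<Sum>c\<in>?S. card {x \<in> UNIV. x ^ 2 = c})"
    by (rule card_eq_sum_fibers) auto
  also have "\<dots> = card {x :: 'f. x ^ 2 = 0} + (\<Sum>c\<in>?S - {0}. card {x. x ^ 2 = c})"
    by (subst sum.remove[of _ 0]) (auto intro: image_eqI[of _ _ 0])
  also have "\<dots> \<le> 1 + (\<Sum>c\<in>?S - {0}. 2)"
    using fib by (intro add_mono sum_mono) auto
  also have "\<dots> = 1 + 2 * (card ?S - 1)"
    by (subst sum_constant, subst card_Diff_singleton) (auto intro: image_eqI[of _ _ 0])
  finally show ?thesis
    using card_gt_0_iff[of ?S] by fastforce
qed

text \<open>The values \<open>c * x ^ 2\<close> and the values \<open>g - d * y ^ 2\<close> each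
  fill more than half of the field, so they share one.\<close>

lemma diagonal_binary_universal:
  fixes c d g :: "'f::{field, finite}"
  assumes "c \<noteq> 0" "d \<noteq> 0"
  obtains x y where "c * x ^ 2 + d * y ^ 2 = g"
proof -
  let ?S = "range (\<lambda>x :: 'f. x ^ 2)"
  let ?P = "(\<lambda>a. c * a) ` ?S" and ?R = "(\<lambda>a. g - d * a) ` ?S"
  have "card ?P = card ?S" "card ?R = card ?S"
    using assms by (auto intro!: card_image simp: inj_on_def)
  moreover have "card (?P \<union> ?R) \<le> CARD('f)" by (rule card_mono) auto
  ultimately have "?P \<inter> ?R \<noteq> {}"
    using card_squares[where 'f = 'f] card_Un_disjoint[of ?P ?R] by fastforce
  then obtain x y where "c * x ^ 2 = g - d * y ^ 2" by auto
  then show ?thesis by (intro that[of x y]) simp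
qed

context polar_geometry
begin

lemma max_isotropics_eq_gens:
  assumes "\<And>W. isotropic scale f W \<longleftrightarrow> iso W"
  shows "max_isotropics scale f = gens"
  by (simp add: max_isotropics_def gens_def assms)

lemma obtain_outside:
  assumes "dim S < dim T"
  obtains v where "v \<in> T" "v \<notin> S"
proof -
  have "\<not> T \<subseteq> S" using assms dim_subset[of T S] by linarith
  then show ?thesis using that by blast
qed

end

section \<open>Quadratic forms\<close>

locale quadratic_geometry = finite_vector_space scale
  for scale :: "'f::{field, finite} \<Rightarrow> 'u::{ab_group_add, finite} \<Rightarrow> 'u" (infixr \<open>*s\<close> 75) +
  fixes Q :: "'u \<Rightarrow> 'f"
  assumes quadratic: "quadratic_form scale Q" and nondegenerate: "nondegenerate_quadratic Q"
begin

lemma Q_scale: "Q (a *s v) = a ^ 2 * Q v"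
  using quadratic by (simp add: quadratic_form_def)

lemma Q_add: "Q (v + w) = Q v + Q w + polar_form Q v w"
  by (simp add: polar_form_def)

lemma polar_sym: "polar_form Q v w = polar_form Q w v"
  by (simp add: polar_form_def add.commute)

lemma polar_linear:
  "polar_form Q (v + w) u = polar_form Q v u + polar_form Q w u"
  "polar_form Q (a *s v) u = a * polar_form Q v u"
  using quadratic by (auto simp: quadratic_form_def bilinear_form_def Vector_Spaces.linear_iff)

lemma polar_linear_right:
  "polar_form Q u (v + w) = polar_form Q u v + polar_form Q u w"
  "polar_form Q u (a *s v) = a * polar_form Q u v"
  by (simp_all only: polar_sym[of u] polar_linear)

lemma polar_self: "polar_form Q v v = 2 * Q v"
proof -
  have "v + v = 2 *s v"
    using scale_left_distrib[of 1 1 v] by simp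
  then have "Q (v + v) = 4 * Q v" by (simp add: Q_scale)
  then show ?thesis by (simp add: polar_form_def)
qed

text \<open>For singular \<open>m\<close>, \<open>Q (v + a *s m)\<close> is affine in
  \<open>a\<close> with slope \<open>polar_form Q v m\<close>, hence the single zero.\<close>

sublocale polar_geometry scale "polar_form Q" "\<lambda>v. Q v = 0" 1
proof
  show "Q 0 = 0" using Q_scale[of 0 0] by simp
  show "polar_form Q v w = 0 \<Longrightarrow> polar_form Q w v = 0" for v w
    by (simp only: polar_sym[of w v])
  show "Q v = 0 \<Longrightarrow> (\<And>w. polar_form Q w v = 0) \<Longrightarrow> v = 0" for v
    using nondegenerate polar_sym by (metis nondegenerate_quadratic_def)
  show "card {a. Q (v + a *s m) = 0} = 1" if "Q m = 0" "polar_form Q v m \<noteq> 0" for m v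
  proof -
    have "Q (v + a *s m) = Q v + a * polar_form Q v m" for a
      using that(1) by (simp add: Q_add Q_scale polar_linear_right)
    then have "Q (v + a *s m) = 0 \<longleftrightarrow> a = - Q v / polar_form Q v m" for a
      using nonzero_eq_divide_eq[OF that(2), of a "- Q v"] by (simp only: add_eq_0_iff)
    then have "{a. Q (v + a *s m) = 0} = {- Q v / polar_form Q v m}"
      by simp
    then show ?thesis by simp
  qed
qed (simp_all add: polar_linear Q_scale Q_add polar_self)

lemma isotropic_iff: "isotropic scale (Quadratic Q) W \<longleftrightarrow> iso W"
proof -
  have "v \<in> perp W" if "subspace W" "\<forall>w\<in>W. Q w = 0" "v \<in> W" for v
    using that by (simp add: perp_def polar_form_def subspace_add)
  then show ?thesis by (auto simp: isotropic_def iso_def)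
qed

text \<open>
  An anisotropic quadratic form over a finite field has dimension at most 2, applied to
  \<open>perp M\<close> modulo \<open>M\<close>.
\<close>

lemma dim_le_gens:
  assumes M: "M \<in> gens"
  shows "dim (UNIV :: 'u set) \<le> 2 * dim M + 2"
proof (rule ccontr)
  assume "\<not> ?thesis"
  then have big: "dim M + 3 \<le> dim (perp M)" using dim_perp[OF gens_iso[OF M]] by linarith
  note sM = gens_subspace[OF M]
  have absorb: "v \<in> M" if "v \<in> perp M" "Q v = 0" for v
    using gens_absorb[OF M] that by blast
  have "dim M < dim (perp M)" using big by simp
  then obtain v where v: "v \<in> perp M" "v \<notin> M" by (rule obtain_outside)
  let ?K = "perp M \<inter> perp {v}"
  have K: "dim (perp M) \<le> dim ?K + 1" by (rule dim_Int_perp_singleton[OF subspace_perp])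
  then have "dim (span (insert v M)) < dim ?K"
    using big dim_span_insert[OF sM v(2)] by linarith
  \<comment> \<open>In characteristic 2 \<open>v\<close> is orthogonal to itself, so
    \<open>w\<close> must avoid \<open>span (insert v M)\<close> and not just
    \<open>M\<close>.\<close>
  then obtain w where w: "w \<in> ?K" "w \<notin> span (insert v M)" by (rule obtain_outside)
  have wM: "w \<notin> M" using w(2) span_superset[of "insert v M"] by auto
  have Qv: "Q v \<noteq> 0" and Qw: "Q w \<noteq> 0" using absorb v w wM by auto
  have wv: "polar_form Q w v = 0" using w by (simp add: perp_def)
  show False
  proof (cases "(2 :: 'f) = 0")
    case True
    have neg: "- a = a" for a :: 'f
      using True by (metis mult_2 mult_zero_left add_eq_0_iff)
    \<comment> \<open>Every element is a square in characteristic 2, so some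
      \<open>a *s v + w\<close> is singular, which puts \<open>w\<close> in
      \<open>span (insert v M)\<close>.\<close>
    have "inj (\<lambda>a :: 'f. a ^ 2)"
      by (rule injI) (auto simp: power2_eq_iff neg)
    then have "surj (\<lambda>a :: 'f. a ^ 2)" by (simp add: finite_UNIV_inj_surj)
    then obtain a where a: "- Q w / Q v = a ^ 2" by (metis surjE)
    let ?u = "a *s v + w"
    have "polar_form Q (a *s v) w = 0" using wv by (simp add: polar_linear polar_sym[of v w])
    then have "Q ?u = a ^ 2 * Q v + Q w" by (simp add: Q_add Q_scale)
    then have "Q ?u = 0" using Qv by (simp flip: a)
    moreover have "?u \<in> perp M"
      using v w subspace_perp by (simp add: subspace_add subspace_scale)
    ultimately have "?u \<in> M" by (rule absorb[rotated])
    then have "?u - a *s v \<in> span (insert v M)"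
      by (intro span_diff span_scale span_base) auto
    then show False using w by simp
  next
    case False
    let ?L = "?K \<inter> perp {w}"
    have "dim ?K \<le> dim ?L + 1"
      by (rule dim_Int_perp_singleton) (simp add: subspace_inter subspace_perp)
    then have "dim M < dim ?L" using K big by linarith
    then obtain u where u: "u \<in> ?L" "u \<notin> M" by (rule obtain_outside)
    \<comment> \<open>A combination of \<open>v\<close> and \<open>w\<close> compensates the third
      orthogonal vector \<open>u\<close>. The sum is singular, hence in \<open>M\<close>, and its
      products with \<open>v\<close> and \<open>w\<close> force \<open>a\<close> and
      \<open>b\<close> to be 0.\<close>
    obtain a b where ab: "Q v * a ^ 2 + Q w * b ^ 2 = - Q u"
      using diagonal_binary_universal[OF Qv Qw] by blast
    let ?z = "(a *s v + b *s w) + u"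
    have orth: "polar_form Q v w = 0" "polar_form Q w v = 0" "polar_form Q u v = 0"
      "polar_form Q v u = 0" "polar_form Q u w = 0" "polar_form Q w u = 0"
      using wv u polar_sym[of v] polar_sym[of w u] by (simp_all add: perp_def)
    have "polar_form Q (a *s v) (b *s w) = 0"
      using orth by (simp add: polar_linear polar_linear_right)
    moreover have "polar_form Q (a *s v + b *s w) u = 0"
      using orth by (simp add: polar_linear)
    ultimately have "Q ?z = a ^ 2 * Q v + b ^ 2 * Q w + Q u"
      by (simp add: Q_add Q_scale)
    also have "\<dots> = 0" using ab by (simp add: mult.commute)
    finally have "Q ?z = 0" .
    moreover have "?z \<in> perp M"
      using v w u subspace_perp by (simp add: subspace_add subspace_scale)
    ultimately have z: "?z \<in> M" by (rule absorb[rotated])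
    have "polar_form Q v ?z = 0" "polar_form Q w ?z = 0"
      using v w z by (auto simp: perp_def)
    then have "a * (2 * Q v) = 0" "b * (2 * Q w) = 0"
      using orth by (simp_all add: polar_linear_right polar_self)
    then have "a = 0" "b = 0" using False Qv Qw by auto
    then show False using z u by simp
  qed
qed

end

section \<open>Symplectic forms\<close>

locale symplectic_geometry = finite_vector_space scale
  for scale :: "'f::{field, finite} \<Rightarrow> 'u::{ab_group_add, finite} \<Rightarrow> 'u" (infixr \<open>*s\<close> 75) +
  fixes B :: "'u \<Rightarrow> 'u \<Rightarrow> 'f"
  assumes symplectic: "symplectic_form scale B" and nondegenerate: "nondegenerate B"
begin

lemma B_linear:
  "B (v + w) u = B v u + B w u" "B (a *s v) u = a * B v u" "B u (v + w) = B u v + B u w"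
  using symplectic by (auto simp: symplectic_form_def bilinear_form_def Vector_Spaces.linear_iff)

lemma B_self: "B v v = 0"
  using symplectic by (simp add: symplectic_form_def)

lemma B_skew: "B v w = - B w v"
proof -
  have "B v w + B w v = 0"
    using B_self[of "v + w"] unfolding B_linear by (simp add: B_self add.commute)
  then show ?thesis by (simp add: eq_neg_iff_add_eq_0)
qed

sublocale polar_geometry scale B "\<lambda>_. True" "CARD('f)"
proof
  show "B v w = 0 \<Longrightarrow> B w v = 0" for v w
    using B_skew[of w v] by simp
  show "(\<And>w. B w v = 0) \<Longrightarrow> v = 0" for v
    using nondegenerate B_skew[of v] by (simp add: nondegenerate_def)
qed (simp_all add: B_linear B_self)

lemma isotropic_iff: "isotropic scale (Symplectic B) W \<longleftrightarrow> iso W"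
  by (auto simp: isotropic_def iso_def perp_def)

lemma dim_le_gens:
  assumes M: "M \<in> gens"
  shows "dim (UNIV :: 'u set) \<le> 2 * dim M + 1"
proof -
  have "perp M \<subseteq> M" using gens_absorb[OF M] by auto
  then have "dim (perp M) \<le> dim M" by (rule dim_subset)
  then show ?thesis using dim_perp[OF gens_iso[OF M]] by linarith
qed

end

section \<open>Hermitian forms\<close>

locale hermitian_geometry = finite_vector_space scale
  for scale :: "'f::{field, finite} \<Rightarrow> 'u::{ab_group_add, finite} \<Rightarrow> 'u" (infixr \<open>*s\<close> 75) +
  fixes H :: "'u \<Rightarrow> 'u \<Rightarrow> 'f" and r :: nat
  assumes hermitian: "hermitian_form scale r H" and nondegenerate: "nondegenerate H"
    and card_field: "CARD('f) = r * r"
    \<comment> \<open>Additivity of the conjugation \<open>a \<mapsto> a ^ r\<close>; it comes from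
      the characteristic when the locale is interpreted.\<close>
    and frobenius: "\<And>a b :: 'f. (a + b) ^ r = a ^ r + b ^ r"
begin

lemma r_gt_1: "r > 1"
proof (rule ccontr)
  assume "\<not> ?thesis"
  then have "r = 0 \<or> r = 1" by auto
  then show False using card_field_ge_2 card_field by auto
qed

lemma H_linear: "H (v + w) u = H v u + H w u" "H (a *s v) u = a * H v u"
  using hermitian unfolding hermitian_form_def Vector_Spaces.linear_iff by blast+

lemma H_conj: "H w v = H v w ^ r"
  using hermitian unfolding hermitian_form_def by blast

lemma H_add_right: "H u (v + w) = H u v + H u w"
  by (simp only: H_conj[of u] H_linear frobenius)

lemma H_scale_right: "H u (a *s v) = a ^ r * H u v"
  by (simp only: H_conj[of u] H_linear power_mult_distrib)

lemma H_refl: "H v w = 0 \<Longrightarrow> H w v = 0"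
  using r_gt_1 by (simp only: H_conj[of w v]) (simp add: zero_power)

text \<open>With \<open>b = a * H m v\<close> the value on the line is
  \<open>H v v + b + b ^ r\<close>, so the singular vectors correspond to the fibre of the trace
  over \<open>- H v v\<close>.\<close>

sublocale polar_geometry scale H "\<lambda>v. H v v = 0" r
proof
  show "H 0 0 = 0" using H_linear(2)[of 0 0 0] by simp
  show "H v v = 0 \<Longrightarrow> (\<And>w. H w v = 0) \<Longrightarrow> v = 0" for v
    using nondegenerate H_refl by (metis nondegenerate_def)
  show "card {a. H (v + a *s m) (v + a *s m) = 0} = r" if m: "H m m = 0" "H v m \<noteq> 0" for m v
  proof -
    let ?c = "H m v"
    have c: "?c \<noteq> 0" using H_refl m by blast
    have eq: "H (v + a *s m) (v + a *s m) = H v v + (a * ?c + (a * ?c) ^ r)" for a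
      using m by (simp add: H_linear H_add_right H_scale_right H_conj[of v m] power_mult_distrib
          algebra_simps)
    have "(- H v v) ^ r = - H v v"
      using frobenius[of "H v v" "- H v v"] H_conj[of v v, symmetric] r_gt_1 by (simp add: add_eq_0_iff zero_power)
    then have "card {b. b + b ^ r = - H v v} = r"
      by (intro card_trace_fibre card_field r_gt_1 frobenius)
    moreover have "bij_betw (\<lambda>a. a * ?c) {a. H (v + a *s m) (v + a *s m) = 0} {b. b + b ^ r = - H v v}"
      using c by (intro bij_betw_byWitness[of _ "\<lambda>b. b / ?c"]) (auto simp: eq add_eq_0_iff)
    ultimately show ?thesis by (simp add: bij_betw_same_card)
  qed
  show "H (v + w) (v + w) = 0" if "H v v = 0" "H w w = 0" "H v w = 0" for v w
    using that H_refl[OF that(3)] by (simp add: H_linear H_add_right)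
qed (simp_all only: H_linear H_scale_right H_refl mult_zero_right)

lemma isotropic_iff: "isotropic scale (Hermitian H) W \<longleftrightarrow> iso W"
  by (auto simp: isotropic_def iso_def perp_def)

text \<open>Otherwise \<open>perp M\<close> contains orthogonal nonsingular vectors \<open>v\<close>
  and \<open>w\<close>. The norm reaches \<open>- H w w / H v v\<close>, so some
  \<open>a *s v + w\<close> is singular and hence in \<open>M\<close>; pairing with \<open>v\<close>
  gives \<open>a = 0\<close>, which would put \<open>w\<close> in \<open>M\<close>.\<close>

lemma dim_le_gens:
  assumes M: "M \<in> gens"
  shows "dim (UNIV :: 'u set) \<le> 2 * dim M + 1"
proof (rule ccontr)
  assume "\<not> ?thesis"
  then have big: "dim M + 2 \<le> dim (perp M)" using dim_perp[OF gens_iso[OF M]] by linarith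
  have absorb: "v \<in> M" if "v \<in> perp M" "H v v = 0" for v
    using gens_absorb[OF M] that by blast
  have "dim M < dim (perp M)" using big by simp
  then obtain v where v: "v \<in> perp M" "v \<notin> M" by (rule obtain_outside)
  let ?K = "perp M \<inter> perp {v}"
  have "dim (perp M) \<le> dim ?K + 1" by (rule dim_Int_perp_singleton[OF subspace_perp])
  then have "dim M < dim ?K" using big by linarith
  then obtain w where w: "w \<in> ?K" "w \<notin> M" by (rule obtain_outside)
  have nz: "H v v \<noteq> 0" "H w w \<noteq> 0" using absorb v w by auto
  have wv: "H w v = 0" "H v w = 0" using w H_refl by (auto simp: perp_def)
  let ?k = "- H w w / H v v"
  have neg: "(- a) ^ r = - (a ^ r)" for a :: 'f
    using frobenius[of a "- a"] r_gt_1 by (simp add: zero_power eq_neg_iff_add_eq_0 add.commute)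
  have "?k ^ r = ?k"
    using H_conj[of v v, symmetric] H_conj[of w w, symmetric] by (simp add: power_divide neg)
  moreover have "?k \<noteq> 0" using nz by simp
  ultimately obtain a where a: "a ^ (r + 1) = ?k"
    using norm_surjective[OF card_field r_gt_1] by blast
  let ?z = "a *s v + w"
  have "H ?z ?z = a ^ (r + 1) * H v v + H w w"
    using wv by (simp add: H_linear H_add_right H_scale_right)
  also have "\<dots> = 0" unfolding a using nz by simp
  finally have "H ?z ?z = 0" .
  moreover have "?z \<in> perp M"
    using v w subspace_perp by (simp add: subspace_add subspace_scale)
  ultimately have z: "?z \<in> M" by (rule absorb[rotated])
  then have "H v ?z = 0" using v by (simp add: perp_def)
  then have "H ?z v = 0" by (rule H_refl)
  then have "a = 0" using wv nz by (simp add: H_linear)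
  then show False using z w by simp
qed

end

section \<open>The action on the vectors attached to subspaces\<close>

context polar_rank
begin

lemma eta_N_eq: "eta_N gens x \<eta> z = (if z \<in> gens \<and> x \<inter> z = \<eta> then 1 else 0)"
  by (simp add: eta_N_def std_basis_def)

lemma sum_eta_N:
  "(\<Sum>\<zeta>\<in>Z. eta_N gens x \<zeta> z) = (if z \<in> gens \<and> x \<inter> z \<in> Z then 1 else 0)"
  by (cases "z \<in> gens") (simp_all add: eta_N_eq)

lemma mat_vec_A_eta_N:
  "mat_vec gens A (eta_N gens x \<eta>) z = of_nat (card {y. adj y z \<and> x \<inter> y = \<eta>})"
proof -
  have "mat_vec gens A (eta_N gens x \<eta>) z = (\<Sum>y\<in>gens. if adj y z \<and> x \<inter> y = \<eta> then 1 else 0)"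
    unfolding mat_vec_def by (rule sum.cong) (auto simp: A_def eta_N_eq adj_sym)
  also have "\<dots> = of_nat (card (gens \<inter> {y. adj y z \<and> x \<inter> y = \<eta>}))"
    by (simp add: sum.If_cases)
  also have "gens \<inter> {y. adj y z \<and> x \<inter> y = \<eta>} = {y. adj y z \<and> x \<inter> y = \<eta>}"
    using adjD(1) by blast
  finally show ?thesis .
qed

lemma dual_polar_adjacency_eq_A:
  assumes "max_isotropics scale f = gens"
  shows "dual_polar_adjacency scale f D = A"
  using D_pos by (intro ext) (auto simp: dual_polar_adjacency_def A_def adj_def assms)

lemma theta_1:
  assumes q: "q = real CARD('f)" and e: "real t = q powr (e + 1)"
  shows "complex_of_real (dual_polar_theta q e D 1) = \<theta> 1"
proof -
  have "q - 1 \<noteq> 0" using card_field_ge_2 q by simp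
  then have "dual_polar_theta q e D 1 = real t * ((q ^ (D - 1) - 1) / (q - 1)) - 1"
    unfolding dual_polar_theta_def dual_polar_a1_def e by (simp add: field_simps)
  also have "\<dots> = real (t * gauss (D - 1)) - real (gauss 1)"
    using real_gauss[of "D - 1"] q by (simp add: gauss_def)
  finally show ?thesis
    unfolding \<theta>_def by (metis of_real_diff of_real_of_nat_eq)
qed

text \<open>Since \<open>e\<close> may be a half integer, the real powers are first expressed
  through \<open>t\<close>: \<open>q powr e\<close> is \<open>t / q\<close> and
  \<open>q powr (D + e)\<close> is \<open>t * q ^ (D - 1)\<close>. The rest is field
  arithmetic.\<close>

lemma theta_star:
  assumes q: "q = real CARD('f)" and e: "real t = q powr (e + 1)" and i: "i \<le> D"
  shows "complex_of_real (dual_polar_theta_star q e D i) = \<alpha> * qc ^ (D - i) + \<beta>"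
proof -
  have q2: "q \<ge> 2" using card_field_ge_2 q by simp
  let ?c = "real t * q ^ (D - 1)"
  have qe: "q powr e = real t / q" using e q2 by (simp add: powr_add)
  have "real D + e = (e + 1) + real (D - 1)" using D_pos by (simp add: of_nat_diff)
  then have qDe: "q powr (real D + e) = ?c"
    using e q2 by (simp add: powr_add powr_realpow del: of_nat_diff)
  have qi: "q powr (- real i) = q ^ (D - i) / q ^ D"
    using q2 i by (simp add: powr_minus powr_realpow power_diff field_simps)
  have nz: "q \<noteq> 0" "q - 1 \<noteq> 0" "real t + q \<noteq> 0" "q ^ D \<noteq> 0"
    using q2 by (auto simp: add_nonneg_eq_0_iff)
  have "dual_polar_theta_star q e D i =
      (?c + q) / (real t / q + 1) * ((q ^ (D - i) / q ^ D * (?c + 1) - real t / q - 1) / (q - 1))"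
    unfolding dual_polar_theta_star_def qe qDe qi ..
  also have "\<dots> = (?c + q) * (q / (real t + q)) * ((q ^ (D - i) / q ^ D * (?c + 1) - (real t + q) / q) / (q - 1))"
    using nz by (simp add: field_simps)
  also have "\<dots> = (?c + q) * q * (?c + 1) / ((real t + q) * q ^ D * (q - 1)) * q ^ (D - i)
      + - (?c + q) * ((q / (real t + q)) * ((real t + q) / q)) / (q - 1)"
  proof -
    have "a * u * ((b - w) / d) = a * u * b / d + - a * (u * w) / d" for a u b w d :: real
      by (simp add: right_diff_distrib diff_divide_distrib)
    moreover have "(?c + q) * (q / (real t + q)) * (q ^ (D - i) / q ^ D * (?c + 1)) / (q - 1)
        = (?c + q) * q * (?c + 1) / ((real t + q) * q ^ D * (q - 1)) * q ^ (D - i)"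
      by simp
    ultimately show ?thesis by (simp only:)
  qed
  also have "(q / (real t + q)) * ((real t + q) / q) = 1" using nz by simp
  finally have "dual_polar_theta_star q e D i =
      (?c + q) * q * (?c + 1) / ((real t + q) * q ^ D * (q - 1)) * q ^ (D - i) + - (?c + q) / (q - 1)"
    by simp
  then show ?thesis
    by (simp add: \<alpha>_def \<beta>_def cc_def q)
qed

text \<open>The entries at \<open>z\<close> are compared according to the position of
  \<open>x \<inter> z\<close> relative to \<open>\<eta>\<close>, using the three neighbour counts.
  For \<open>i = D\<close> the integer equation makes the first sum empty; for \<open>i = 0\<close>
  the second sum is empty, so the power with exponent -1 has no effect.\<close>

lemma adjacency_eta_N:
  assumes q: "q = real CARD('f)" and a1: "a1 = real t - 1"
    and x: "x \<in> gens" and \<eta>: "\<eta> \<in> subspaces_of scale x" "dim \<eta> = D - i" and i: "i \<le> D"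
  shows "mat_vec gens A (eta_N gens x \<eta>) z =
      complex_of_real (a1 * ((q ^ i - 1) / (q - 1))) * eta_N gens x \<eta> z
         + (\<Sum>\<zeta> | \<zeta> \<in> subspaces_of scale x \<and> \<zeta> \<subseteq> \<eta> \<and>
                int (dim \<zeta>) = int D - int i - 1. eta_N gens x \<zeta> z)
         + complex_of_real ((a1 + 1) * q powi (int i - 1)) *
           (\<Sum>\<zeta>' | \<zeta>' \<in> subspaces_of scale x \<and> \<eta> \<subseteq> \<zeta>' \<and>
                dim \<zeta>' = D - i + 1. eta_N gens x \<zeta>' z)"
proof (cases "z \<in> gens")
  case False
  then have "{y. adj y z \<and> x \<inter> y = \<eta>} = {}" using adjD(2) by blast
  then show ?thesis using False by (simp add: mat_vec_A_eta_N sum_eta_N eta_N_eq)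
next
  case z: True
  have s\<eta>: "subspace \<eta>" "\<eta> \<subseteq> x" using \<eta> by (auto simp: subspaces_of_def)
  have xz: "subspace (x \<inter> z)" using x z by (simp add: gens_subspace subspace_inter)
  have m1: "x \<inter> z \<in> {\<zeta>. \<zeta> \<in> subspaces_of scale x \<and> \<zeta> \<subseteq> \<eta> \<and> int (dim \<zeta>) = int D - int i - 1}
      \<longleftrightarrow> hyperplane (x \<inter> z) \<eta>"
    using xz \<eta>(2) i by (auto simp: subspaces_of_def hyperplane_def)
  have m2: "x \<inter> z \<in> {\<zeta>'. \<zeta>' \<in> subspaces_of scale x \<and> \<eta> \<subseteq> \<zeta>' \<and> dim \<zeta>' = D - i + 1}
      \<longleftrightarrow> hyperplane \<eta> (x \<inter> z)"
    using xz s\<eta> \<eta>(2) by (auto simp: subspaces_of_def hyperplane_def)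
  have rhs: "complex_of_real (a1 * ((q ^ i - 1) / (q - 1))) * eta_N gens x \<eta> z
         + (\<Sum>\<zeta> | \<zeta> \<in> subspaces_of scale x \<and> \<zeta> \<subseteq> \<eta> \<and>
                int (dim \<zeta>) = int D - int i - 1. eta_N gens x \<zeta> z)
         + complex_of_real ((a1 + 1) * q powi (int i - 1)) *
           (\<Sum>\<zeta>' | \<zeta>' \<in> subspaces_of scale x \<and> \<eta> \<subseteq> \<zeta>' \<and>
                dim \<zeta>' = D - i + 1. eta_N gens x \<zeta>' z) =
      complex_of_real (a1 * real (gauss i)) * (if x \<inter> z = \<eta> then 1 else 0)
         + (if hyperplane (x \<inter> z) \<eta> then 1 else 0)
         + complex_of_real ((a1 + 1) * q powi (int i - 1)) * (if hyperplane \<eta> (x \<inter> z) then 1 else 0)"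
  proof -
    have "(q ^ i - 1) / (q - 1) = real (gauss i)" using q real_gauss[of i] by simp
    moreover have "eta_N gens x \<eta> z = (if x \<inter> z = \<eta> then 1 else 0)"
      using z by (simp only: eta_N_eq) simp
    ultimately show ?thesis
      unfolding sum_eta_N m1 m2 using z by (simp only:) simp
  qed
  have irrefl: "\<not> hyperplane T T" for T by (simp add: hyperplane_def)
  have asym: "hyperplane T S \<Longrightarrow> \<not> hyperplane S T" for T S by (simp add: hyperplane_def)
  consider "x \<inter> z = \<eta>" | "hyperplane (x \<inter> z) \<eta>" | "hyperplane \<eta> (x \<inter> z)"
    | "x \<inter> z \<noteq> \<eta>" "\<not> hyperplane (x \<inter> z) \<eta>" "\<not> hyperplane \<eta> (x \<inter> z)" by blast
  then show ?thesis
  proof cases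
    case 1
    have "card {y. adj y z \<and> x \<inter> y = \<eta>} + gauss i = t * gauss i"
      using card_adj_same_Int[OF x z] 1 \<eta>(2) i by simp
    then have "real (card {y. adj y z \<and> x \<inter> y = \<eta>} + gauss i) = real (t * gauss i)"
      by (simp only:)
    then have "real (card {y. adj y z \<and> x \<inter> y = \<eta>}) = a1 * real (gauss i)"
      by (simp add: a1 left_diff_distrib)
    then have "complex_of_real (real (card {y. adj y z \<and> x \<inter> y = \<eta>})) =
        complex_of_real (a1 * real (gauss i))"
      by (simp only:)
    then have "of_nat (card {y. adj y z \<and> x \<inter> y = \<eta>}) = complex_of_real (a1 * real (gauss i))"
      unfolding of_real_of_nat_eq .
    then show ?thesis
      unfolding rhs mat_vec_A_eta_N using 1 irrefl by simp
  next
    case 2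
    then have "x \<inter> z \<noteq> \<eta>" "\<not> hyperplane \<eta> (x \<inter> z)" using irrefl asym by auto
    then show ?thesis
      unfolding rhs mat_vec_A_eta_N using 2 card_adj_larger_Int[OF x z 2 s\<eta>] by simp
  next
    case 3
    then have ne: "x \<inter> z \<noteq> \<eta>" "\<not> hyperplane (x \<inter> z) \<eta>" using irrefl asym by auto
    \<comment> \<open>Here \<open>x \<inter> z\<close> has dimension \<open>D - i + 1\<close>, which
      excludes \<open>i = 0\<close> and makes the integer power a natural one.\<close>
    have "dim (x \<inter> z) \<le> D" using dim_subset[of "x \<inter> z" z] dim_gens[OF z] by simp
    then have i1: "1 \<le> i" using 3 \<eta>(2) i by (simp add: hyperplane_def)
    then have "card {y. adj y z \<and> x \<inter> y = \<eta>} = t * CARD('f) ^ (i - 1)"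
      using card_adj_smaller_Int[OF x z 3] \<eta>(2) i by simp
    moreover have "q powi (int i - 1) = q ^ (i - 1)"
      using i1 by (simp add: power_int_def nat_diff_distrib)
    ultimately have "complex_of_real ((a1 + 1) * q powi (int i - 1)) =
        of_nat (card {y. adj y z \<and> x \<inter> y = \<eta>})"
      by (simp add: a1 q)
    then show ?thesis
      unfolding rhs mat_vec_A_eta_N using 3 ne by simp
  next
    case 4
    have "{y. adj y z \<and> x \<inter> y = \<eta>} = {}"
      using adj_Int_cases[OF x] 4 by fastforce
    then show ?thesis
      unfolding rhs mat_vec_A_eta_N using 4 by simp
  qed
qed

text \<open>The matrix is diagonal and the vector is supported where
  \<open>x \<inter> z = \<eta>\<close>; there the diagonal entry is
  \<open>\<alpha> * qc ^ (D - i) + \<beta>\<close>.\<close>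

lemma dual_adjacency_eta_N:
  assumes q: "q = real CARD('f)" and e: "real t = q powr (e + 1)"
    and f: "max_isotropics scale f = gens"
    and x: "x \<in> gens" and \<eta>: "dim \<eta> = D - i" and i: "i \<le> D"
  shows "mat_vec gens (dual_polar_dual_adjacency scale f q e D x) (eta_N gens x \<eta>) z =
      complex_of_real (dual_polar_theta_star q e D i) * eta_N gens x \<eta> z"
proof -
  have E: "dual_polar_idempotent scale f q e D 1 = E1"
    unfolding dual_polar_idempotent_def f dual_polar_adjacency_eq_A[OF f] theta_1[OF q e]
    by (rule primitive_idempotent_1)
  have diag: "mat_vec gens (dual_polar_dual_adjacency scale f q e D x) (eta_N gens x \<eta>) z =
      (if z \<in> gens then of_nat (card gens) * E1 x z * eta_N gens x \<eta> z else 0)"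
    unfolding mat_vec_def dual_polar_dual_adjacency_def f E
    by (simp add: if_distrib[of "\<lambda>a. a * _"] cong: if_cong)
  show ?thesis
  proof (cases "z \<in> gens \<and> x \<inter> z = \<eta>")
    case True
    then have "subspace (x \<inter> z)" "dim (x \<inter> z) = D - i"
      using x \<eta> by (auto simp: gens_subspace intro!: subspace_inter)
    then have "card (x \<inter> z) = CARD('f) ^ (D - i)"
      using card_subspace[of "x \<inter> z"] by simp
    then have "of_nat (card gens) * E1 x z = \<alpha> * qc ^ (D - i) + \<beta>"
      using True x gens_nonempty by (auto simp: E1_def)
    then show ?thesis
      unfolding diag theta_star[OF q e i] using True by simp
  next
    case False
    then show ?thesis unfolding diag by (auto simp: eta_N_eq)
  qed
qed

end

section \<open>The classical types as instances of one geometry\<close>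

lemma polar_space_imp_polar_rank:
  fixes scale :: "'f::{field, finite} \<Rightarrow> 'u::{ab_group_add, finite} \<Rightarrow> 'u"
  assumes ps: "polar_space scale T p n D f" and T: "polar_e T \<noteq> - 1"
  obtains B sing s where "polar_rank scale B sing s D"
    "max_isotropics scale f = polar_geometry.gens scale B sing"
    "polar_q T p n = real CARD('f)"
    "real (polar_rank.t scale s D) = polar_q T p n powr (polar_e T + 1)"
proof -
  note witness = that
  interpret finite_vector_space scale
    using ps by (simp add: polar_space_def finite_vector_space_def)
  have p: "prime p" and D: "1 \<le> D" using ps by (simp_all add: polar_space_def)
  let ?N = "dim (UNIV :: 'u set)"
  \<comment> \<open>Here \<open>s\<close> is 1, so \<open>t\<close> is q^k for \<open>k\<close> the
    excess of the dimension over \<open>2 * D\<close>.\<close>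
  have quad: thesis
    if Q: "f = Quadratic Q" "quadratic_form scale Q" "nondegenerate_quadratic Q"
      and dims: "\<And>M. M \<in> polar_geometry.gens scale (polar_form Q) (\<lambda>v. Q v = 0) \<Longrightarrow> dim M = D"
      and N: "?N = 2 * D + k" "k \<ge> 1" and q: "polar_q T p n = real CARD('f)" "polar_e T + 1 = real k"
    for Q k
  proof -
    interpret quadratic_geometry scale Q by unfold_locales (fact Q)+
    interpret polar_rank scale "polar_form Q" "\<lambda>v. Q v = 0" 1 D
      by unfold_locales (use dims D in auto)
    have "real CARD('f) > 0" by simp
    then have "real t = real CARD('f) powr real k"
      unfolding t_def by (simp add: N powr_realpow)
    moreover have "max_isotropics scale f = gens"
      by (rule max_isotropics_eq_gens) (simp add: Q isotropic_iff)
    ultimately show ?thesis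
      by (intro witness[OF polar_rank_axioms]) (simp_all only: q)
  qed
  have herm: thesis
    if H: "f = Hermitian H" "hermitian_form scale (p ^ n) H" "nondegenerate H"
      and q: "CARD('f) = p ^ (2 * n)" "polar_q T p n = real CARD('f)"
      and N: "?N = 2 * D + k" "k \<le> 1" "polar_e T + 1 = real k + 1 / 2" for H k
  proof -
    have CH: "CHAR('f) = p" using CHAR_eq_prime[OF q(1) p] .
    interpret hermitian_geometry scale H "p ^ n"
    proof unfold_locales
      show "CARD('f) = p ^ n * p ^ n" using q by (simp add: mult_2 power_add)
      show "(a + b) ^ (p ^ n) = a ^ (p ^ n) + b ^ (p ^ n)" for a b :: 'f
        by (rule freshmans_dream'[of _ n]) (simp_all add: CH p)
    qed (fact H)+
    interpret polar_rank scale H "\<lambda>v. H v v = 0" "p ^ n" D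
    proof unfold_locales
      fix M assume M: "M \<in> gens"
      show "dim M = D"
        using dim_le_gens[OF M] dim_iso_le[OF gens_iso[OF M]] N by linarith
    qed (fact D)
    \<comment> \<open>The field has order \<open>?r\<close> squared, so \<open>t\<close>, which is
      \<open>?r\<close> times q^k, equals q^(k + 1/2).\<close>
    let ?r = "real (p ^ n)"
    have r0: "?r > 0" using p prime_gt_0_nat by simp
    have qr: "real CARD('f) = ?r powr 2"
      using r0 by (simp add: card_field powr_numeral power2_eq_square)
    have "real t = ?r * real CARD('f) ^ k" by (simp add: t_def N)
    also have "real CARD('f) ^ k = (?r powr 2) powr real k"
      unfolding qr using r0 by (intro powr_realpow[symmetric]) simp
    also have "\<dots> = ?r powr (2 * real k)" by (rule powr_powr)
    also have "?r * ?r powr (2 * real k) = ?r powr (1 + 2 * real k)"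
      unfolding powr_add powr_one[OF less_imp_le[OF r0]] ..
    also have "1 + 2 * real k = 2 * (real k + 1 / 2)" by simp
    also have "?r powr \<dots> = real CARD('f) powr (real k + 1 / 2)"
      unfolding qr by (rule powr_powr[symmetric])
    finally have "real t = real CARD('f) powr (real k + 1 / 2)" .
    moreover have "max_isotropics scale f = gens"
      by (rule max_isotropics_eq_gens) (simp add: H isotropic_iff)
    ultimately show ?thesis
      by (intro witness[OF polar_rank_axioms]) (simp_all only: q(2) N(3))
  qed
  show ?thesis
  proof (cases T)
    case Type_B
    then obtain Q where Q: "f = Quadratic Q" "quadratic_form scale Q" "nondegenerate_quadratic Q"
      and N: "?N = 2 * D + 1" and q: "CARD('f) = p ^ n"
      using ps by (auto simp: polar_space_def)
    interpret G: quadratic_geometry scale Q by unfold_locales (fact Q)+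
    show ?thesis
    proof (rule quad[OF Q])
      show "dim M = D" if M: "M \<in> G.gens" for M
        using G.dim_le_gens[OF M] G.dim_iso_le[OF G.gens_iso[OF M]] N by linarith
    qed (use N q Type_B in auto)
  next
    case Type_2D
    then obtain Q where Q: "f = Quadratic Q" "quadratic_form scale Q" "nondegenerate_quadratic Q"
      and N: "?N = 2 * D + 2" and q: "CARD('f) = p ^ n" and W: "witt_index scale f = D"
      using ps by (auto simp: polar_space_def)
    interpret G: quadratic_geometry scale Q by unfold_locales (fact Q)+
    \<comment> \<open>The dimension bounds would leave both \<open>D\<close> and
      \<open>D + 1\<close> possible; the Witt index decides.\<close>
    let ?I = "dim ` {W. G.iso W}"
    have fin: "finite ?I" "?I \<noteq> {}" using G.iso_0 by auto
    have I: "Max ?I = D" using W by (simp add: witt_index_def Q(1) G.isotropic_iff)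
    show ?thesis
    proof (rule quad[OF Q])
      show "dim M = D" if M: "M \<in> G.gens" for M
      proof (rule antisym)
        show "dim M \<le> D" using Max_ge[OF fin(1)] G.gens_iso[OF M] I by auto
        have "D \<in> ?I" using Max_in[OF fin] I by simp
        then show "D \<le> dim M" using G.dim_iso_le_gens[OF M] by auto
      qed
    qed (use N q Type_2D in auto)
  next
    case Type_C
    then obtain B where B: "f = Symplectic B" "symplectic_form scale B" "nondegenerate B"
      and N: "?N = 2 * D" and q: "CARD('f) = p ^ n"
      using ps by (auto simp: polar_space_def)
    interpret symplectic_geometry scale B by unfold_locales (fact B)+
    interpret polar_rank scale B "\<lambda>_. True" "CARD('f)" D
    proof unfold_locales
      fix M assume M: "M \<in> gens"
      show "dim M = D"
        using dim_le_gens[OF M] dim_iso_le[OF gens_iso[OF M]] N by linarith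
    qed (fact D)
    have "max_isotropics scale f = gens"
      by (rule max_isotropics_eq_gens) (simp add: B isotropic_iff)
    moreover have "polar_q T p n = real CARD('f)" "polar_e T = 0" using q Type_C by auto
    moreover have "real t = real CARD('f)" by (simp add: t_def N)
    ultimately show ?thesis
      using witness[OF polar_rank_axioms] by simp
  next
    case Type_2A_even
    then show ?thesis
      using ps herm[of _ 1] by (auto simp: polar_space_def)
  next
    case Type_2A_odd
    then show ?thesis
      using ps herm[of _ 0] by (auto simp: polar_space_def)
  \<comment> \<open>What remains is \<open>Type_D\<close>, where \<open>polar_e\<close> is
    -1.\<close>
  qed (use T in simp)
qed

theorem theorem13p11:
  fixes scale :: "'f::{field, finite} \<Rightarrow> 'u::{ab_group_add, finite} \<Rightarrow> 'u"
    and T :: polar_type and p n D i :: nat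
    and f :: "('f, 'u) form"
    and q e a1 :: real
    and X :: "'u set set"
    and A Astar :: "'u set \<Rightarrow> 'u set \<Rightarrow> complex"
    and x \<eta> :: "'u set"
  assumes "polar_space scale T p n D f"
    and "q = polar_q T p n" and "e = polar_e T" and "a1 = dual_polar_a1 q e"
    and "X = max_isotropics scale f"
    and "A = dual_polar_adjacency scale f D"
    and "e \<noteq> - 1"
    and "x \<in> X"
    and "Astar = dual_polar_dual_adjacency scale f q e D x"
    and "i \<le> D"
    and "\<eta> \<in> subspaces_of scale x"
    and "vector_space.dim scale \<eta> = D - i"
  shows "mat_vec X A (eta_N X x \<eta>) =
      (\<lambda>z. complex_of_real (a1 * ((q ^ i - 1) / (q - 1))) * eta_N X x \<eta> z
         + (\<Sum>\<zeta> | \<zeta> \<in> subspaces_of scale x \<and> \<zeta> \<subseteq> \<eta> \<and>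
                int (vector_space.dim scale \<zeta>) = int D - int i - 1. eta_N X x \<zeta> z)
         + complex_of_real ((a1 + 1) * q powi (int i - 1)) *
           (\<Sum>\<zeta>' | \<zeta>' \<in> subspaces_of scale x \<and> \<eta> \<subseteq> \<zeta>' \<and>
                vector_space.dim scale \<zeta>' = D - i + 1. eta_N X x \<zeta>' z))
    \<and> mat_vec X Astar (eta_N X x \<eta>) =
      (\<lambda>z. complex_of_real (dual_polar_theta_star q e D i) * eta_N X x \<eta> z)"
proof -
  obtain B sing s where pr: "polar_rank scale B sing s D"
    and X: "max_isotropics scale f = polar_geometry.gens scale B sing"
    and q: "q = real CARD('f)" and t: "real (polar_rank.t scale s D) = q powr (e + 1)"
    using polar_space_imp_polar_rank[OF assms(1)] assms(2,3,7) by metis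
  interpret G: polar_rank scale B sing s D by (rule pr)
  have a1: "a1 = real G.t - 1" using assms(4) t by (simp add: dual_polar_a1_def)
  have x: "x \<in> G.gens" using assms(5,8) X by simp
  show ?thesis
    unfolding assms(5,6,9) X G.dual_polar_adjacency_eq_A[OF X]
    using G.adjacency_eta_N[OF q a1 x assms(11,12,10)]
      G.dual_adjacency_eta_N[OF q t X x assms(12,10)]
    by (intro conjI ext)
qed

end
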